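(* Fix integers $r>0$ and $a,b$ with $\gcd(a,b)=1$ and $ab>0$. For every integer $n>rab$ there is a bijection $B^r_{a,b;n}\to B^r_{a,b;n+ab}$ that preserves the Betti statistic $\beta$.
   Context: Partitions are identified with Young diagrams: finite sets $\lambda\subset\mathbb{Z}_{\ge0}^2$ of boxes $(i,j)$ such that $(i,j)\in\lambda$ implies $(i',j')\in\lambda$ for $0\le i'\le i$, $0\le j'\le j$. For $j\ge0$ let $l(j)=\#\{i:(i,j)\in\lambda\}$ and for $i\ge0$ let $c(i)=\#\{j:(i,j)\in\lambda\}$. Box $(i,j)$ has $(a,b;n)$-color $ai+bj\bmod n$. $\lambda$ is $(a,b;n)$-balanced if each residue class mod $n$ is the color of exactly $r$ boxes; $B^r_{a,b;n}$ denotes the set of $(a,b;n)$-balanced partitions of $rn$. An arrow from $(l,s)$ to $(i,j)$ is invariant if $a(l-i)+b(s-j)\equiv 0\pmod n$. For $(i,j)\in\lambda$, $d_{i,j}$ is the arrow from $(l(j),j)$ to $(i,c(i)-1)$ and $u_{i,j}$ the arrow from $(i,c(i))$ to $(l(j)-1,j)$. The Betti statistic of $\lambda\in B^r_{a,b;n}$ (computed with modulus $n$) is $\beta(\lambda)=\#\{(i,j)\in\lambda:d_{i,j}\text{ invariant}\}+\#\{(i,j)\in\lambda:u_{i,j}\text{ invariant and } i=l(j)-1\}$. *)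

theory Defs
  imports Main
begin

definition young :: "(nat \<times> nat) set \<Rightarrow> bool" where
  "young Y \<longleftrightarrow> finite Y \<and>
     (\<forall>i j i' j'. (i, j) \<in> Y \<and> i' \<le> i \<and> j' \<le> j \<longrightarrow> (i', j') \<in> Y)"

definition lcnt :: "(nat \<times> nat) set \<Rightarrow> nat \<Rightarrow> nat" where
  "lcnt Y j = card {i. (i, j) \<in> Y}"

definition ccnt :: "(nat \<times> nat) set \<Rightarrow> nat \<Rightarrow> nat" where
  "ccnt Y i = card {j. (i, j) \<in> Y}"

definition color :: "int \<Rightarrow> int \<Rightarrow> int \<Rightarrow> nat \<times> nat \<Rightarrow> int" where
  "color a b n p = (a * int (fst p) + b * int (snd p)) mod n"

definition balanced :: "nat \<Rightarrow> int \<Rightarrow> int \<Rightarrow> int \<Rightarrow> (nat \<times> nat) set \<Rightarrow> bool" where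
  "balanced r a b n Y \<longleftrightarrow> (\<forall>k \<in> {0..<n}. card {p \<in> Y. color a b n p = k} = r)"

definition Bset :: "nat \<Rightarrow> int \<Rightarrow> int \<Rightarrow> int \<Rightarrow> (nat \<times> nat) set set" where
  "Bset r a b n = {Y. young Y \<and> int (card Y) = int r * n \<and> balanced r a b n Y}"

definition invariant_arrow :: "int \<Rightarrow> int \<Rightarrow> int \<Rightarrow> int \<times> int \<Rightarrow> int \<times> int \<Rightarrow> bool" where
  "invariant_arrow a b n src tgt \<longleftrightarrow>
     (a * (fst src - fst tgt) + b * (snd src - snd tgt)) mod n = 0"

definition d_inv :: "int \<Rightarrow> int \<Rightarrow> int \<Rightarrow> (nat \<times> nat) set \<Rightarrow> nat \<Rightarrow> nat \<Rightarrow> bool" where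
  "d_inv a b n Y i j \<longleftrightarrow>
     invariant_arrow a b n (int (lcnt Y j), int j) (int i, int (ccnt Y i) - 1)"

definition u_inv :: "int \<Rightarrow> int \<Rightarrow> int \<Rightarrow> (nat \<times> nat) set \<Rightarrow> nat \<Rightarrow> nat \<Rightarrow> bool" where
  "u_inv a b n Y i j \<longleftrightarrow>
     invariant_arrow a b n (int i, int (ccnt Y i)) (int (lcnt Y j) - 1, int j)"

definition betti :: "int \<Rightarrow> int \<Rightarrow> int \<Rightarrow> (nat \<times> nat) set \<Rightarrow> nat" where
  "betti a b n Y =
     card {(i, j) \<in> Y. d_inv a b n Y i j}
   + card {(i, j) \<in> Y. u_inv a b n Y i j \<and> int i = int (lcnt Y j) - 1}"

end

theory Submission
  imports Defs
begin

text \<open>We may take \<open>a, b > 0\<close>. Give the box \<open>(x, y)\<close> the weight \<open>a x + b y\<close>. There are \<open>r + 1\<close> cells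
  \<open>((r - s) b, s a)\<close> of weight \<open>r a b\<close>, and a balanced diagram misses one of them; so it consists of a
  core rectangle together with rows \<open>y < Y = s a\<close> and columns \<open>x < X = (r - s) b\<close>. Let
  \<open>c = (r - 1) a b\<close> and let \<open>S\<close> be the numerical semigroup generated by \<open>a\<close> and \<open>b\<close>. Moving back by
  \<open>(b, 0)\<close> in a row and by \<open>(0, a)\<close> in a column injects the boxes of a color \<open>c + a b + \<sigma> < n\<close> with
  \<open>\<sigma> \<in> S\<close> into those of color \<open>c + \<sigma>\<close>. Both color classes have \<open>r\<close> boxes, so this is a bijection,
  and the diagram is straight where a row or column crosses into \<open>c + m n + S\<close>.

  Let the level \<open>v(w)\<close> be the number of \<open>m \<ge> 0\<close> with \<open>w \<in> c + m n + S\<close>. Moving every row cell of weight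
  \<open>w\<close> by \<open>(b v(w), 0)\<close> and every column cell by \<open>(0, a v(w))\<close> turns congruence of weights modulo \<open>n\<close>
  into congruence modulo \<open>n + a b\<close>. The gap that opens when a row or column passes from one level
  to the next is filled with boxes. Straightness makes the result a balanced diagram and makes the
  construction invertible, and the endpoints of the arrows counted by the Betti statistic move
  compatibly if their levels are read off at weight \<open>w - a\<close> for \<open>d\<close> and \<open>w - b\<close> for \<open>u\<close>.\<close>

section \<open>Numerical semigroups with two generators\<close>

definition nspan :: "int \<Rightarrow> int \<Rightarrow> int set" where
  "nspan a b = {z. \<exists>i t. 0 \<le> i \<and> 0 \<le> t \<and> z = a * i + b * t}"

lemma nspanI: "0 \<le> i \<Longrightarrow> 0 \<le> t \<Longrightarrow> z = a * i + b * t \<Longrightarrow> z \<in> nspan a b"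
  unfolding nspan_def by blast

lemma nspanE:
  assumes "z \<in> nspan a b"
  obtains i t where "0 \<le> i" "0 \<le> t" "z = a * i + b * t"
  using assms unfolding nspan_def by blast

lemma nspan_commute: "nspan a b = nspan b a"
  unfolding nspan_def by (rule Collect_cong) (metis add.commute)

lemma nspan_add:
  assumes "x \<in> nspan a b" "y \<in> nspan a b"
  shows "x + y \<in> nspan a b"
proof -
  obtain i t where x: "0 \<le> i" "0 \<le> t" "x = a * i + b * t" using assms(1) by (rule nspanE)
  obtain j u where y: "0 \<le> j" "0 \<le> u" "y = a * j + b * u" using assms(2) by (rule nspanE)
  show ?thesis by (rule nspanI[of "i + j" "t + u"]) (use x y in \<open>auto simp: algebra_simps\<close>)
qed

lemma nspan_mult:
  assumes "x \<in> nspan a b" "0 \<le> k"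
  shows "k * x \<in> nspan a b"
proof -
  obtain i t where x: "0 \<le> i" "0 \<le> t" "x = a * i + b * t" using assms(1) by (rule nspanE)
  show ?thesis by (rule nspanI[of "k * i" "k * t"]) (use x assms in \<open>auto simp: algebra_simps\<close>)
qed

text \<open>Euclid's lemma applied to \<open>a * (i' - i) = b * (t - t')\<close>. Cells of equal
  weight thus lie on one line, in steps of \<open>(b, - a)\<close>.\<close>

lemma coprime_repr_unique:
  fixes a b i t i' t' :: int
  assumes "0 < a" "0 < b" "coprime a b" "a * i + b * t = a * i' + b * t'"
  obtains k where "i' = i + b * k" "t' = t - a * k"
proof -
  have e: "a * (i' - i) = b * (t - t')" using assms(4) by (simp add: algebra_simps)
  then have "b dvd a * (i' - i)" by simp
  then have "b dvd i' - i"
    using assms(3) by (metis coprime_commute coprime_dvd_mult_right_iff)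
  then obtain k where k: "i' - i = b * k" by blast
  have "b * (a * k) = b * (t - t')" using e k by (simp add: algebra_simps)
  then have "a * k = t - t'" using assms(2) by simp
  then show ?thesis using that[of k] k by linarith
qed

text \<open>\<open>a * b - a - b\<close> is the Frobenius number. Every integer has a representation
  whose coefficient of \<open>b\<close> lies between 0 and \<open>a - 1\<close>; beyond the
  Frobenius number the other coefficient must then exceed -1.\<close>

lemma nspan_large:
  assumes "0 < a" "0 < b" "coprime a b" "a * b - a - b < z"
  shows "z \<in> nspan a b"
proof -
  obtain u v where uv: "u * a + v * b = (1::int)"
    using assms(3) bezout_int[of a b] by (metis coprime_iff_gcd_eq_1)
  \<comment> \<open>The Bezout coefficient \<open>z * v\<close> is reduced modulo \<open>a\<close>;
    the quotient \<open>q\<close> is paid back as \<open>b * q\<close> in the coefficient of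
    \<open>a\<close>.\<close>
  define t where "t = (z * v) mod a"
  define q where "q = (z * v) div a"
  have t: "0 \<le> t" "t < a" unfolding t_def using assms by auto
  have tq: "z * v = a * q + t" unfolding t_def q_def by simp
  define i where "i = z * u + b * q"
  have "z = z * (u * a + v * b)" using uv by simp
  also have "\<dots> = a * (z * u) + b * (z * v)" by (simp add: algebra_simps)
  also have "\<dots> = a * i + b * t" unfolding tq i_def by (simp add: algebra_simps)
  finally have z: "z = a * i + b * t" .
  have "b * t \<le> b * (a - 1)" using t assms by (intro mult_left_mono) auto
  then have "a * i > a * (-1)" using z assms(4) by (simp add: algebra_simps)
  then have "i > -1" using assms(1) mult_less_cancel_left_pos by blast
  then show ?thesis using t z by (intro nspanI[of i t]) auto
qed

lemma nspan_nonneg: "0 < a \<Longrightarrow> 0 < b \<Longrightarrow> z \<in> nspan a b \<Longrightarrow> 0 \<le> z"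
  by (erule nspanE) simp

text \<open>A coefficient \<open>i\<close> of at least \<open>b\<close>, or \<open>t\<close> of at
  least \<open>a\<close>, could absorb the subtraction of \<open>a * b\<close>. The pairs
  \<open>(i, t)\<close> later index the weights of inserted blocks.\<close>

lemma nspan_diff_prod:
  assumes "0 < a" "0 < b" "z \<in> nspan a b" "z - a * b \<notin> nspan a b"
  obtains i t where "0 \<le> i" "i < b" "0 \<le> t" "t < a" "z = a * i + b * t"
proof -
  obtain i t where z: "0 \<le> i" "0 \<le> t" "z = a * i + b * t" using assms(3) by (rule nspanE)
  have "i < b"
  proof (rule ccontr)
    assume "\<not> i < b"
    then have "z - a * b \<in> nspan a b" using z by (intro nspanI[of "i - b" t]) (auto simp: algebra_simps)
    then show False using assms by simp
  qed
  moreover have "t < a"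
  proof (rule ccontr)
    assume "\<not> t < a"
    then have "z - a * b \<in> nspan a b" using z by (intro nspanI[of i "t - a"]) (auto simp: algebra_simps)
    then show False using assms by simp
  qed
  ultimately show ?thesis using z that by blast
qed

text \<open>For the definition of levels: the cut is the first integer from \<open>k0\<close> on at
  which \<open>P\<close> fails.\<close>

lemma int_threshold:
  fixes P :: "int \<Rightarrow> bool"
  assumes anti: "\<And>k. P (k + 1) \<Longrightarrow> P k" and "P k0" and "\<not> P k1"
  obtains v where "\<And>k. k < v \<longleftrightarrow> P k"
proof -
  have down: "P j" if "P k" "j \<le> k" for j k
    using that(2,1) by (induction j rule: int_le_induct) (use anti in \<open>metis diff_add_cancel\<close>)+
  define N where "N = (LEAST N. \<not> P (k0 + int N))"
  have "k0 \<le> k1" using down[OF assms(2), of k1] assms(3) by linarith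
  then have "\<not> P (k0 + int (nat (k1 - k0)))" using assms(3) by simp
  then have N: "\<not> P (k0 + int N)" unfolding N_def by (rule LeastI)
  have less: "P (k0 + int m)" if "m < N" for m
    using not_less_Least[of m "\<lambda>N. \<not> P (k0 + int N)"] that unfolding N_def by simp
  show ?thesis
  proof (rule that[of "k0 + int N"])
    fix k
    show "k < k0 + int N \<longleftrightarrow> P k"
    proof
      assume k: "k < k0 + int N"
      show "P k"
      proof (cases "k \<le> k0")
        case True
        then show ?thesis using down assms(2) by blast
      next
        case False
        then show ?thesis using less[of "nat (k - k0)"] k by simp
      qed
    next
      assume "P k"
      then show "k < k0 + int N" using down N by (meson not_le)
    qed
  qed
qed

section \<open>Straightness\<close>

text \<open>Coordinates are integers because undoing a shift may lead to negative positions, which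
  then simply count as absent.\<close>

definition diagram :: "(int \<Rightarrow> int \<Rightarrow> bool) \<Rightarrow> bool" where
  "diagram L \<longleftrightarrow> (\<forall>x y. L x y \<longrightarrow> 0 \<le> x \<and> 0 \<le> y)
     \<and> (\<forall>x y x' y'. L x y \<and> 0 \<le> x' \<and> x' \<le> x \<and> 0 \<le> y' \<and> y' \<le> y \<longrightarrow> L x' y')
     \<and> finite {(x, y). L x y}"

text \<open>\<open>k\<close> ranges over all integers instead of residues, so that weights can be
  compared by divisibility alone.\<close>

definition equidistributed :: "int \<Rightarrow> int \<Rightarrow> int \<Rightarrow> int \<Rightarrow> (int \<Rightarrow> int \<Rightarrow> bool) \<Rightarrow> bool" where
  "equidistributed a b n r L \<longleftrightarrow>
     (\<forall>k. int (card {(x, y). L x y \<and> n dvd a * x + b * y - k}) = r)"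

lemma diagram_pos: "diagram L \<Longrightarrow> L x y \<Longrightarrow> 0 \<le> x \<and> 0 \<le> y"
  unfolding diagram_def by blast

lemma diagram_down:
  "diagram L \<Longrightarrow> L x y \<Longrightarrow> 0 \<le> x' \<Longrightarrow> x' \<le> x \<Longrightarrow> 0 \<le> y' \<Longrightarrow> y' \<le> y \<Longrightarrow> L x' y'"
  unfolding diagram_def by blast

lemma diagram_finite: "diagram L \<Longrightarrow> finite {(x, y). L x y}"
  unfolding diagram_def by blast

lemma finite_transpose:
  assumes "finite {(x, y). P x y}"
  shows "finite {(x, y). P y x}"
proof -
  have "{(x, y). P y x} = prod.swap ` {(x, y). P x y}" by force
  then show ?thesis using assms by simp
qed

lemma card_transpose: "card {(x, y). P y x} = card {(x, y). P x y}"
proof -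
  have "{(x, y). P y x} = prod.swap ` {(x, y). P x y}" by force
  then show ?thesis by (simp add: card_image)
qed

lemma diagram_transpose: "diagram L \<Longrightarrow> diagram (\<lambda>x y. L y x)"
  unfolding diagram_def using finite_transpose[of L] by blast

lemma equidistributed_transpose:
  "equidistributed a b n r L \<Longrightarrow> equidistributed b a n r (\<lambda>x y. L y x)"
  unfolding equidistributed_def
  using card_transpose[of "\<lambda>x y. L x y \<and> n dvd a * x + b * y - k" for k]
  by (simp add: add.commute)

text \<open>The parameter \<open>s\<close> stays existential so that transposition only swaps
  \<open>X\<close> and \<open>Y\<close>. Only \<open>n_gt\<close> involves \<open>n\<close>, so the
  same corner serves the larger modulus too.\<close>

locale corner =
  fixes a b n c r X Y :: int
  assumes a_pos: "0 < a" and b_pos: "0 < b" and cop: "coprime a b"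
    and r_pos: "0 < r" and n_gt: "r * a * b < n"
    and c_eq: "c = (r - 1) * a * b"
    and XY: "\<exists>s. 0 \<le> s \<and> s \<le> r \<and> X = (r - s) * b \<and> Y = s * a"
begin

lemma transposed: "corner b a n c r Y X"
proof
  show "0 < b" "0 < a" "coprime b a" "0 < r" "r * b * a < n" "c = (r - 1) * b * a"
    using a_pos b_pos cop r_pos n_gt c_eq by (auto simp: coprime_commute algebra_simps)
  obtain s where "0 \<le> s" "s \<le> r" "X = (r - s) * b" "Y = s * a" using XY by blast
  then show "\<exists>s. 0 \<le> s \<and> s \<le> r \<and> Y = (r - s) * a \<and> X = s * b"
    by (intro exI[of _ "r - s"]) auto
qed

lemma X_nonneg: "0 \<le> X" and Y_nonneg: "0 \<le> Y" and Y_le: "Y \<le> r * a"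
  using XY a_pos b_pos by (auto intro: mult_right_mono)

lemma ab_pos: "0 < a * b"
  using a_pos b_pos by simp

lemma c_nonneg: "0 \<le> c"
  unfolding c_eq using a_pos b_pos r_pos by simp

lemma c_ab: "c + a * b < n"
  using n_gt c_eq by (simp add: algebra_simps)

lemma ab_less_n: "a * b < n"
  using c_ab c_nonneg by linarith

lemma large: "a * b - a - b < z \<Longrightarrow> z \<in> nspan a b"
  by (rule nspan_large[OF a_pos b_pos cop])

lemma n_nspan: "n \<in> nspan a b"
  using ab_less_n a_pos b_pos by (intro large) linarith

lemma nspan_pos: "z \<in> nspan a b \<Longrightarrow> 0 \<le> z"
  using nspan_nonneg a_pos b_pos by blast

lemma a_mult: "0 \<le> i \<Longrightarrow> 0 \<le> a * i" and b_mult: "0 \<le> i \<Longrightarrow> 0 \<le> b * i"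
  using a_pos b_pos by auto

lemma a_mult_le: "i \<le> b \<Longrightarrow> a * i \<le> a * b"
  using a_pos by simp

lemma a_mult_less: "i < b \<Longrightarrow> a * i < a * b"
  using a_pos by simp

lemma b_mult_le: "t \<le> a \<Longrightarrow> b * t \<le> a * b"
  using b_pos by simp

lemma b_mult_less: "t < a \<Longrightarrow> b * t < a * b"
  using b_pos by simp

text \<open>Otherwise the cell \<open>(i + (r - 1) * b, t)\<close> would have the weight of
  \<open>(x, y)\<close>, and \<open>(x, y)\<close> would be \<open>k\<close> steps of
  \<open>(- b, a)\<close> away from it. Here \<open>y < s * a\<close> forces \<open>k < s\<close>,
  hence \<open>X \<le> x\<close>.\<close>

lemma core_below:
  assumes "x < X" "y < Y"
  shows "a * x + b * y - c \<notin> nspan a b"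
proof
  assume "a * x + b * y - c \<in> nspan a b"
  then obtain i t where it: "0 \<le> i" "0 \<le> t" "a * x + b * y - c = a * i + b * t" by (rule nspanE)
  obtain s where s: "X = (r - s) * b" "Y = s * a" using XY by blast
  have "a * x + b * y = a * (i + (r - 1) * b) + b * t"
    using it(3) c_eq by (simp add: algebra_simps)
  then obtain k where k: "i + (r - 1) * b = x + b * k" "t = y - a * k"
    by (rule coprime_repr_unique[OF a_pos b_pos cop])
  have "a * k < a * s" using k(2) it(2) assms(2) s(2) by (simp add: algebra_simps)
  then have "k + 1 \<le> s" using a_pos by simp
  then have "b * (k + 1) \<le> b * s" using b_pos by simp
  then have "X \<le> x" using k(1) it(1) s(1) by (simp add: algebra_simps)
  then show False using assms by simp
qed

text \<open>Since \<open>n\<close> itself lies in the semigroup, \<open>core_below\<close> covers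
  all \<open>m \<ge> 0\<close>.\<close>

lemma level_pos:
  assumes "\<sigma> \<in> nspan a b" "0 \<le> m" "a * x + b * y = c + \<sigma> + m * n"
  shows "x < X \<Longrightarrow> Y \<le> y" and "y < Y \<Longrightarrow> X \<le> x"
proof -
  have "a * x + b * y - c \<in> nspan a b"
    using nspan_add[OF assms(1) nspan_mult[OF n_nspan assms(2)]] assms(3) by (simp add: algebra_simps)
  then show "x < X \<Longrightarrow> Y \<le> y" "y < Y \<Longrightarrow> X \<le> x" using core_below not_le by blast+
qed

text \<open>Applied to weights of boxes, which are nonnegative, this excludes negative multiples of
  the modulus.\<close>

lemma mult_nonneg_if:
  assumes "0 \<le> z + m * n" "z < n"
  shows "0 \<le> m"
proof (rule ccontr)
  assume "\<not> 0 \<le> m"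
  then have "m * n \<le> (-1) * n" using ab_less_n ab_pos by (intro mult_right_mono) auto
  then show False using assms by linarith
qed

text \<open>Equal class sizes make the injection \<open>f\<close> from \<open>P\<close> into
  \<open>Q\<close> onto; the preimage of \<open>(x, y)\<close> is the required box.\<close>

lemma straight:
  assumes L: "diagram L" "equidistributed a b n r L" "\<not> L X Y"
    and s: "\<sigma> \<in> nspan a b" "c + a * b + \<sigma> < n"
    and q: "L x y" "a * x + b * y = c + \<sigma> + m * n"
  shows "y < Y \<Longrightarrow> L (x + b) y" and "x < X \<Longrightarrow> L x (y + a)"
proof -
  define P where "P = {(x, y). L x y \<and> n dvd a * x + b * y - (c + \<sigma> + a * b)}"
  define Q where "Q = {(x, y). L x y \<and> n dvd a * x + b * y - (c + \<sigma>)}"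
  define f where "f = (\<lambda>(x, y). if y < Y then (x - b, y) else (x, y - a))"
  have fin: "finite P" "finite Q"
    unfolding P_def Q_def by (auto intro!: finite_subset[OF _ diagram_finite[OF L(1)]])
  have card: "card P = card Q"
  proof -
    have "int (card P) = r" "int (card Q) = r"
      using L(2) unfolding equidistributed_def P_def Q_def by blast+
    then show ?thesis by simp
  qed
  have corner: "x < X" if "L x y" "Y \<le> y" for x y
    using that L(3) X_nonneg Y_nonneg diagram_down[OF L(1) that(1), of X Y] by linarith
  \<comment> \<open>The first conjunct keeps the images of row boxes and of column boxes apart,
    which gives injectivity.\<close>
  have P: "(if y < Y then X \<le> x - b else x < X \<and> Y \<le> y - a)
      \<and> f (x, y) \<in> Q" if xy: "(x, y) \<in> P" for x y
  proof -
    have Lxy: "L x y" using xy unfolding P_def by simp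
    then have pos: "0 \<le> x" "0 \<le> y" using diagram_pos[OF L(1)] by auto
    obtain m where m: "a * x + b * y - (c + \<sigma> + a * b) = n * m"
      using xy unfolding P_def by auto
    have "0 \<le> a * x + b * y" using pos a_mult b_mult by simp
    then have "0 \<le> (c + \<sigma> + a * b) + m * n" using m by (simp add: algebra_simps)
    then have m0: "0 \<le> m" by (rule mult_nonneg_if) (use s in linarith)
    show ?thesis
    proof (cases "y < Y")
      case True
      have eq: "a * (x - b) + b * y = c + \<sigma> + m * n" using m by (simp add: algebra_simps)
      have "X \<le> x - b" using level_pos(2)[OF s(1) m0 eq True] .
      moreover from this have "L (x - b) y"
        using diagram_down[OF L(1) Lxy, of "x - b" y] X_nonneg pos b_pos by simp
      moreover have "n dvd a * (x - b) + b * y - (c + \<sigma>)" unfolding eq by simp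
      ultimately show ?thesis using True unfolding f_def Q_def by simp
    next
      case False
      then have xX: "x < X" using corner Lxy by simp
      have eq: "a * x + b * (y - a) = c + \<sigma> + m * n" using m by (simp add: algebra_simps)
      have "Y \<le> y - a" using level_pos(1)[OF s(1) m0 eq] xX by blast
      moreover from this have "L x (y - a)"
        using diagram_down[OF L(1) Lxy, of x "y - a"] Y_nonneg pos a_pos by simp
      moreover have "n dvd a * x + b * (y - a) - (c + \<sigma>)" unfolding eq by simp
      ultimately show ?thesis using False xX unfolding f_def Q_def by simp
    qed
  qed
  have "inj_on f P"
  proof (rule inj_onI)
    fix p p' assume pp: "p \<in> P" "p' \<in> P" "f p = f p'"
    obtain x y x' y' where "p = (x, y)" "p' = (x', y')" by (cases p, cases p')
    then show "p = p'" using pp P[of x y] P[of x' y'] unfolding f_def by (auto split: if_splits)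
  qed
  moreover have "f ` P \<subseteq> Q" using P by auto
  ultimately have im: "f ` P = Q" using card fin by (metis card_image card_subset_eq)
  have "(x, y) \<in> Q" using q unfolding Q_def by simp
  then obtain x' y' where p: "(x', y') \<in> P" "f (x', y') = (x, y)"
    using im by (metis (no_types, lifting) imageE surj_pair)
  have "0 \<le> a * x + b * y" using diagram_pos[OF L(1) q(1)] a_mult b_mult by simp
  then have "0 \<le> c + \<sigma> + m * n" using q(2) by simp
  then have "0 \<le> m" by (rule mult_nonneg_if) (use s ab_pos in linarith)
  \<comment> \<open>A box of this weight is outside the core, so its preimage lies on the same side,
    row or column, as the box itself.\<close>
  then have lev: "x < X \<Longrightarrow> Y \<le> y" using level_pos(1)[OF s(1) _ q(2)] by simp
  show "y < Y \<Longrightarrow> L (x + b) y" "x < X \<Longrightarrow> L x (y + a)"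
    using p P[OF p(1)] lev unfolding f_def P_def by (auto split: if_splits)
qed

end

section \<open>Levels\<close>

lemma (in corner) enlarged: "corner a b (n + a * b) c r X Y"
proof
  show "r * a * b < n + a * b" using n_gt ab_pos by linarith
qed (use a_pos b_pos cop r_pos c_eq XY in auto)

text \<open>Membership is monotone in \<open>k\<close> because \<open>n\<close> is in the semigroup;
  it holds for very negative \<open>k\<close> by \<open>large\<close> and fails for large
  \<open>k\<close> by nonnegativity. Admitting negative levels makes \<open>v_shift\<close> hold
  without exceptions.\<close>

lemma (in corner) level_exists:
  obtains v where "\<And>k w. k < v w \<longleftrightarrow> w - c - k * n \<in> nspan a b"
proof -
  have "\<exists>v. \<forall>k. k < v \<longleftrightarrow> w - c - k * n \<in> nspan a b" for w
  proof -
    have n1: "1 \<le> n" using ab_less_n ab_pos by linarith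
    have "w - c - k * n \<in> nspan a b" if "w - c - (k + 1) * n \<in> nspan a b" for k
      using nspan_add[OF that n_nspan] by (simp add: algebra_simps)
    moreover have "w - c - (- (\<bar>w\<bar> + c + a * b)) * n \<in> nspan a b"
    proof (rule large)
      define q where "q = \<bar>w\<bar> + c + a * b"
      have "0 \<le> q" unfolding q_def using c_nonneg ab_pos by linarith
      then have "q * 1 \<le> q * n" using n1 by (intro mult_left_mono) auto
      moreover have "a * b + c - w \<le> q" unfolding q_def by linarith
      ultimately have "a * b - a - b < w - c - (- q) * n"
        using a_pos b_pos unfolding minus_mult_left[symmetric] by linarith
      then show "a * b - a - b < w - c - (- (\<bar>w\<bar> + c + a * b)) * n" unfolding q_def .
    qed
    moreover have "w - c - (\<bar>w\<bar> + 1) * n \<notin> nspan a b"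
    proof
      assume "w - c - (\<bar>w\<bar> + 1) * n \<in> nspan a b"
      then have "0 \<le> w - c - (\<bar>w\<bar> + 1) * n" by (rule nspan_pos)
      moreover have "\<bar>w\<bar> * 1 \<le> \<bar>w\<bar> * n"
        using n1 by (intro mult_left_mono) auto
      ultimately show False using c_nonneg n1 by (simp add: distrib_right)
    qed
    ultimately show ?thesis
      using int_threshold[of "\<lambda>k. w - c - k * n \<in> nspan a b"] by metis
  qed
  then obtain v where "\<forall>w k. k < v w \<longleftrightarrow> w - c - k * n \<in> nspan a b" by metis
  then show ?thesis using that by blast
qed

locale levelled = corner +
  fixes v :: "int \<Rightarrow> int"
  assumes v_iff: "k < v w \<longleftrightarrow> w - c - k * n \<in> nspan a b"
begin

lemma levelled_transposed: "levelled b a n c r Y X v"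
  using transposed v_iff by (simp add: levelled_def levelled_axioms_def nspan_commute[of b a])

lemma v_shift: "v (w + k * n) = v w + k"
proof -
  have "j < v (w + k * n) \<longleftrightarrow> j < v w + k" for j
    using v_iff[of j "w + k * n"] v_iff[of "j - k" w] by (simp add: algebra_simps)
  from this[of "v w + k"] this[of "v (w + k * n)"] show ?thesis by linarith
qed

lemma v_mono:
  assumes "\<sigma> \<in> nspan a b"
  shows "v w \<le> v (w + \<sigma>)"
proof -
  have "w - c - (v w - 1) * n \<in> nspan a b" using v_iff[of "v w - 1" w] by simp
  from nspan_add[OF this assms] have "v w - 1 < v (w + \<sigma>)"
    unfolding v_iff by (simp add: algebra_simps)
  then show ?thesis by simp
qed

lemma v_step:
  assumes "n - \<sigma> \<in> nspan a b"
  shows "v (w + \<sigma>) \<le> v w + 1"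
proof (rule ccontr)
  assume "\<not> v (w + \<sigma>) \<le> v w + 1"
  then have "w + \<sigma> - c - (v w + 1) * n \<in> nspan a b" using v_iff[of "v w + 1" "w + \<sigma>"] by simp
  from nspan_add[OF this assms] have "v w < v w"
    unfolding v_iff by (simp add: algebra_simps)
  then show False by simp
qed

lemma a_nspan: "a \<in> nspan a b" and b_nspan: "b \<in> nspan a b" and ab_nspan: "a + b \<in> nspan a b"
  by (auto intro: nspanI[of 1 0] nspanI[of 0 1] nspanI[of 1 1])

lemma v_le:
  "v (w - a) \<le> v w" "v (w - b) \<le> v w" "v (w - (a + b)) \<le> v w"
  using v_mono[OF a_nspan, of "w - a"] v_mono[OF b_nspan, of "w - b"]
    v_mono[OF ab_nspan, of "w - (a + b)"] by simp_all

text \<open>Because \<open>a * b < n\<close>, each of \<open>n - a\<close>, \<open>n - b\<close> and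
  \<open>n - (a + b)\<close> exceeds the Frobenius number, so \<open>v_step\<close> applies.\<close>

lemma v_ge:
  "v w \<le> v (w - a) + 1" "v w \<le> v (w - b) + 1" "v w \<le> v (w - (a + b)) + 1"
proof -
  have "n - a \<in> nspan a b" "n - b \<in> nspan a b" "n - (a + b) \<in> nspan a b"
    using ab_less_n a_pos b_pos by (auto intro!: large)
  from this[THEN v_step] show
    "v w \<le> v (w - a) + 1" "v w \<le> v (w - b) + 1" "v w \<le> v (w - (a + b)) + 1"
    by (metis diff_add_cancel)+
qed

text \<open>The bound \<open>- a - b\<close> leaves room for reading a level up to
  \<open>a + b\<close> below the weight of a box.\<close>

lemma v_nonneg:
  assumes "- a - b \<le> w"
  shows "0 \<le> v w"
proof -
  have "w - c - (-1) * n \<in> nspan a b" using assms c_ab by (intro large) simp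
  then show ?thesis using v_iff[of "-1" w] by simp
qed

lemma v_core: "x < X \<Longrightarrow> y < Y \<Longrightarrow> v (a * x + b * y) \<le> 0"
  using core_below[of x y] v_iff[of 0 "a * x + b * y"] by simp

lemma v_col: "x < X \<Longrightarrow> 0 < v (a * x + b * y) \<Longrightarrow> Y \<le> y"
  and v_row: "y < Y \<Longrightarrow> 0 < v (a * x + b * y) \<Longrightarrow> X \<le> x"
  using v_core[of x y] by linarith+

lemma v_block:
  assumes "\<sigma> \<in> nspan a b" "\<sigma> < n"
  shows "v (c + m * n + \<sigma>) = m + 1"
proof -
  have "m < v (c + m * n + \<sigma>)" unfolding v_iff using assms by simp
  moreover have "\<not> m + 1 < v (c + m * n + \<sigma>)"
    unfolding v_iff using assms nspan_pos[of "\<sigma> - n"] by (auto simp: algebra_simps)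
  ultimately show ?thesis by simp
qed

lemma v_block_a: "0 \<le> i \<Longrightarrow> i \<le> b \<Longrightarrow> v (c + m * n + a * i) = m + 1"
  using a_mult_le[of i] ab_less_n by (intro v_block) (auto intro: nspanI[of i 0])

lemma v_block_b: "0 \<le> t \<Longrightarrow> t \<le> a \<Longrightarrow> v (c + m * n + b * t) = m + 1"
  using b_mult_le[of t] ab_less_n by (intro v_block) (auto intro: nspanI[of 0 t])

text \<open>For \<open>t < a\<close> the number \<open>b * t - a\<close> is a gap of the semigroup.
  So the cell of weight \<open>c + m * n + b * t\<close> is the first one of level
  \<open>m + 1\<close> in its row.\<close>

lemma v_block_b_pred:
  assumes "0 \<le> t" "t < a"
  shows "v (c + m * n + b * t - a) \<le> m"
proof (rule ccontr)
  assume "\<not> ?thesis"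
  then have "m < v (c + m * n + b * t - a)" by simp
  then have "b * t - a \<in> nspan a b" unfolding v_iff by (simp add: algebra_simps)
  then obtain i u where iu: "0 \<le> i" "0 \<le> u" "b * t - a = a * i + b * u" by (rule nspanE)
  have "a * 0 + b * t = a * (i + 1) + b * u" using iu by (simp add: algebra_simps)
  then obtain k where k: "i + 1 = 0 + b * k" "u = t - a * k"
    by (rule coprime_repr_unique[OF a_pos b_pos cop])
  have "0 < b * k" using k iu by simp
  then have "1 \<le> k" using b_pos by (simp add: zero_less_mult_iff)
  then have "a * 1 \<le> a * k" using a_pos by (intro mult_left_mono) auto
  then show False using k(2) iu(2) assms(2) by linarith
qed

text \<open>Let \<open>m + 1\<close> be the level of \<open>w'\<close> for the modulus
  \<open>n + a * b\<close>. If the remainder stays in the semigroup after removing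
  \<open>a * b\<close>, undoing \<open>m + 1\<close> shifts gives \<open>w\<close>; otherwise
  \<open>nspan_diff_prod\<close> gives \<open>i\<close> and \<open>t\<close>. This separates moved
  cells from inserted ones.\<close>

lemma weight_cases:
  obtains (shifted) w where "w' = w + a * b * v w"
  | (block) m i t where "0 \<le> i" "i < b" "0 \<le> t" "t < a"
      "w' = c + m * (n + a * b) + a * i + b * t"
proof -
  interpret E: corner a b "n + a * b" c r X Y by (rule enlarged)
  obtain v' where v': "\<And>k w. k < v' w \<longleftrightarrow> w - c - k * (n + a * b) \<in> nspan a b"
    using E.level_exists by blast
  define m where "m = v' w' - 1"
  have m: "w' - c - m * (n + a * b) \<in> nspan a b" using v'[of m w'] m_def by simp
  have m1: "w' - c - (m + 1) * (n + a * b) \<notin> nspan a b" using v'[of "m + 1" w'] m_def by simp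
  show ?thesis
  proof (cases "w' - c - m * (n + a * b) - a * b \<in> nspan a b")
    case True
    define w where "w = w' - a * b * (m + 1)"
    have "m < v w" unfolding v_iff w_def using True by (simp add: algebra_simps)
    moreover have "\<not> m + 1 < v w" unfolding v_iff w_def using m1 by (simp add: algebra_simps)
    ultimately have "v w = m + 1" by simp
    then show ?thesis using shifted[of w] w_def by simp
  next
    case False
    obtain i t where "0 \<le> i" "i < b" "0 \<le> t" "t < a" "w' - c - m * (n + a * b) = a * i + b * t"
      by (rule nspan_diff_prod[OF a_pos b_pos m False])
    then show ?thesis using block[of i t m] by simp
  qed
qed

end

section \<open>Stretching\<close>

text \<open>Rows \<open>y < Y\<close> are stretched horizontally and columns \<open>x < X\<close> vertically: a cell of
  level \<open>v\<close> moves by \<open>b v\<close>, respectively \<open>a v\<close>, and each level adds a block of \<open>b\<close>, respectively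
  \<open>a\<close>, copies of the first cell of that level.\<close>

locale stretching = levelled +
  fixes L M :: "int \<Rightarrow> int \<Rightarrow> bool"
  assumes L: "diagram L" and M: "diagram M"
    and L_corner: "\<not> L X Y" and M_corner: "\<not> M X Y"
    and row: "y < Y \<Longrightarrow> M (x + b * v (a * x + b * y)) y = L x y"
    and col: "x < X \<Longrightarrow> M x (y + a * v (a * x + b * y)) = L x y"
    and row_block: "\<lbrakk>y < Y; a * x + b * y = c + m * n + b * t; 0 \<le> t; t < a; 0 \<le> i; i < b\<rbrakk>
      \<Longrightarrow> M (x + b * m + i) y = L x y"
    and col_block: "\<lbrakk>x < X; a * x + b * y = c + m * n + a * i; 0 \<le> i; i < b; 0 \<le> t; t < a\<rbrakk>
      \<Longrightarrow> M x (y + a * m + t) = L x y"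
    and row_straight: "\<lbrakk>y < Y; a * x + b * y = c + m * n; L x y\<rbrakk> \<Longrightarrow> L (x + b) y"
    and col_straight: "\<lbrakk>x < X; a * x + b * y = c + m * n; L x y\<rbrakk> \<Longrightarrow> L x (y + a)"
begin

lemma stretching_transposed:
  "stretching b a n c r Y X v (\<lambda>x y. L y x) (\<lambda>x y. M y x)"
proof (rule stretching.intro[OF levelled_transposed], rule stretching_axioms.intro)
  show "diagram (\<lambda>x y. L y x)" "diagram (\<lambda>x y. M y x)"
    using diagram_transpose L M by blast+
  show "\<not> L X Y" "\<not> M X Y" by (rule L_corner, rule M_corner)
  show "M y (x + a * v (b * x + a * y)) = L y x" if "y < X" for x y
    using col[OF that, of x] by (simp add: add.commute)
  show "M (y + b * v (b * x + a * y)) x = L y x" if "x < Y" for x y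
    using row[OF that, of y] by (simp add: add.commute)
  show "M y (x + a * m + i) = L y x"
    if "y < X" "b * x + a * y = c + m * n + a * t" "0 \<le> t" "t < b" "0 \<le> i" "i < a" for x y m i t
    using col_block[OF that(1) _ that(3-6), of x m] that(2) by (simp add: add.commute)
  show "M (y + b * m + t) x = L y x"
    if "x < Y" "b * x + a * y = c + m * n + b * i" "0 \<le> i" "i < a" "0 \<le> t" "t < b" for x y m i t
    using row_block[OF that(1) _ that(3-6), of y m] that(2) by (simp add: add.commute)
  show "L y (x + a)" if "y < X" "b * x + a * y = c + m * n" "L y x" for x y m
    using col_straight[OF that(1) _ that(3), of m] that(2) by (simp add: add.commute)
  show "L (y + b) x" if "x < Y" "b * x + a * y = c + m * n" "L y x" for x y m
    using row_straight[OF that(1) _ that(3), of m] that(2) by (simp add: add.commute)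
qed

lemma L_out: "X \<le> x \<Longrightarrow> Y \<le> y \<Longrightarrow> \<not> L x y"
  using diagram_down[OF L, of x y X Y] X_nonneg Y_nonneg L_corner by blast

lemma M_out: "X \<le> x \<Longrightarrow> Y \<le> y \<Longrightarrow> \<not> M x y"
  using diagram_down[OF M, of x y X Y] X_nonneg Y_nonneg M_corner by blast

lemma weight_nonneg: "0 \<le> x \<Longrightarrow> 0 \<le> y \<Longrightarrow> 0 \<le> a * x + b * y"
  using a_mult b_mult by simp

text \<open>Straightness makes \<open>L\<close> constant from \<open>x - i\<close> to
  \<open>x - i + b\<close>, so the block belonging to \<open>x - i\<close> also carries the value at
  \<open>x\<close>. Hence a shift by \<open>m\<close> is harmless here although the level is
  \<open>m + 1\<close>.\<close>

lemma row_copy_b: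
  assumes "y < Y" "0 \<le> m" "a * x + b * y = c + m * n + a * i" "0 \<le> i" "i \<le> b"
  shows "M (x + b * m) y = L x y"
proof -
  have p: "a * (x - i) + b * y = c + m * n" using assms(3) by (simp add: algebra_simps)
  have v: "v (a * (x - i) + b * y) = m + 1" using v_block_a[of 0 m] b_pos p by simp
  have xi: "0 \<le> x - i" using v_row[OF assms(1), of "x - i"] v assms(2) X_nonneg by linarith
  have "L (x - i) y = L x y"
  proof
    assume "L (x - i) y"
    from row_straight[OF assms(1) p this] show "L x y"
      by (rule diagram_down[OF L]) (use xi assms(4,5) diagram_pos[OF L \<open>L (x - i) y\<close>] in auto)
  next
    assume "L x y"
    then show "L (x - i) y"
      by (rule diagram_down[OF L]) (use xi assms(4) diagram_pos[OF L \<open>L x y\<close>] in auto)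
  qed
  moreover have "M (x + b * m) y = L (x - i) y"
  proof (cases "i < b")
    case True
    then show ?thesis using row_block[OF assms(1), of "x - i" m 0 i] p a_pos assms by simp
  next
    \<comment> \<open>For \<open>i = b\<close> the position has just left the block and is the image
      of \<open>x - i\<close> under its own shift.\<close>
    case False
    then have "i = b" using assms by simp
    then show ?thesis using row[OF assms(1), of "x - i"] v by (simp add: algebra_simps)
  qed
  ultimately show ?thesis by simp
qed

text \<open>Reading the level at a weight lower by \<open>\<delta>\<close> lowers it by at most one,
  and only near the start of a level, where the inserted block makes both shifts hit equal values.
  The offsets are those that occur at the ends of arrows.\<close>

lemma row_shift:
  assumes y: "y < Y" and \<delta>: "\<delta> \<in> {0, a, b, a + b}"
  shows "M (x + b * v (a * x + b * y - \<delta>)) y = L x y"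
proof -
  define w where "w = a * x + b * y"
  define m where "m = v (w - \<delta>)"
  have "v w = m \<or> v w = m + 1"
    using v_le[of w] v_ge[of w] \<delta> unfolding m_def by auto
  then consider "x < 0" | "y < 0" | "0 \<le> x" "0 \<le> y" "v w = m" | "0 \<le> x" "0 \<le> y" "v w = m + 1"
    by linarith
  then have "M (x + b * m) y = L x y"
  proof cases
    \<comment> \<open>Left of the quadrant the level is not positive, so the shift cannot bring the
      cell back in.\<close>
    case 1
    then have "v w \<le> 0" using v_core[of x y] X_nonneg y unfolding w_def by simp
    then have "m \<le> 0" using v_le[of w] \<delta> unfolding m_def by auto
    then have "x + b * m < 0" using 1 b_pos by (simp add: mult_nonneg_nonpos add_neg_nonpos)
    then show ?thesis using 1 diagram_pos[OF L, of x y] diagram_pos[OF M, of "x + b * m" y] by linarith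
  next
    case 2
    then show ?thesis using diagram_pos[OF L, of x y] diagram_pos[OF M, of "x + b * m" y] by linarith
  next
    case 3
    then show ?thesis using row[OF y, of x] unfolding w_def by simp
  next
    case 4
    have m0: "0 \<le> m" unfolding m_def using \<delta> a_pos b_pos weight_nonneg[OF 4(1,2)]
      by (intro v_nonneg) (auto simp: w_def)
    have "m < v w" using 4 by simp
    then have "w - c - m * n \<in> nspan a b" unfolding v_iff .
    then obtain i t where it: "0 \<le> i" "0 \<le> t" "w - c - m * n = a * i + b * t" by (rule nspanE)
    have "\<not> m < v (w - \<delta>)" unfolding m_def by simp
    then have not: "a * i + b * t - \<delta> \<notin> nspan a b" unfolding v_iff using it by (simp add: algebra_simps)
    have weq: "a * x + b * y = c + m * n + a * i + b * t" using it w_def by simp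
    have nn: "\<delta> \<in> {a, b, a + b}" using \<delta> not it nspanI by auto
    \<comment> \<open>These are the positions so close to the start of the level that subtracting
      \<open>\<delta>\<close> leaves it. The pair \<open>i = 0\<close>, \<open>t = a\<close> has the
      same weight as \<open>i = b\<close>, \<open>t = 0\<close>.\<close>
    have "i = 0 \<and> t < a \<or> i = 0 \<and> t = a \<or> t = 0 \<and> i \<le> b"
    proof (rule ccontr)
      assume "\<not> ?thesis"
      then consider "1 \<le> i" "1 \<le> t" | "i = 0" "a + 1 \<le> t" | "t = 0" "b + 1 \<le> i"
        using it by linarith
      then have "a * i + b * t - (a + b) \<in> nspan a b"
      proof cases
        case 1
        then show ?thesis by (intro nspanI[of "i - 1" "t - 1"]) (auto simp: algebra_simps)
      next
        case 2
        then show ?thesis using b_pos by (intro nspanI[of "b - 1" "t - a - 1"]) (auto simp: algebra_simps)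
      next
        case 3
        then show ?thesis using a_pos by (intro nspanI[of "i - b - 1" "a - 1"]) (auto simp: algebra_simps)
      qed
      moreover from nspan_add[OF this a_nspan] nspan_add[OF this b_nspan]
      have "a * i + b * t - b \<in> nspan a b" "a * i + b * t - a \<in> nspan a b" by (simp_all add: algebra_simps)
      ultimately show False using not nn by auto
    qed
    then show ?thesis
    proof (elim disjE conjE)
      assume "i = 0" "t < a"
      then show ?thesis using row_block[OF y, of x m t 0] weq it b_pos by simp
    next
      assume "i = 0" "t = a"
      then show ?thesis using row_copy_b[OF y m0, of x b] weq b_pos by (simp add: algebra_simps)
    next
      assume "t = 0" "i \<le> b"
      then show ?thesis using row_copy_b[OF y m0, of x i] weq it by simp
    qed
  qed
  then show ?thesis unfolding m_def w_def .
qed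

text \<open>\<open>M\<close> is constant along a block and up to the image of the cell that the
  block copies, so no row ends inside a block.\<close>

lemma row_end:
  assumes "y < Y" "M x y" "\<not> M (x + 1) y"
  obtains w where "a * x + b * y = w + a * b * v w"
proof (cases rule: weight_cases[of "a * x + b * y"])
  case (shifted w)
  then show ?thesis using that by blast
next
  case (block m i t)
  have p: "a * (x - b * m - i) + b * y = c + m * n + b * t"
    using block by (simp add: algebra_simps)
  have "M (x + 1) y = L (x - b * m - i) y"
  proof (cases "i + 1 < b")
    case True
    then show ?thesis
      using row_block[OF assms(1) p block(3,4), of "i + 1"] block by (simp add: algebra_simps)
  next
    case False
    then have i: "i = b - 1" using block by simp
    have "v (a * (x - b * m - i) + b * y) = m + 1" using v_block_b block p by simp
    moreover have "x - b * m - i + b * (m + 1) = x + 1" using i by (simp add: algebra_simps)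
    ultimately show ?thesis using row[OF assms(1), of "x - b * m - i"] by metis
  qed
  moreover have "M x y = L (x - b * m - i) y"
    using row_block[OF assms(1) p block(3,4,1,2)] by (simp add: algebra_simps)
  ultimately show ?thesis using assms by simp
qed

end

section \<open>Invariant arrows\<close>

text \<open>An arrow \<open>d\<close> is recorded by its source, the first cell \<open>(x, y)\<close> beyond the end of a row, and
  its target, the top cell \<open>(x', y')\<close> of a column; it belongs to the box \<open>(x', y)\<close>. An arrow \<open>u\<close>
  counted by the Betti statistic is vertical: it joins the last box \<open>(x, y)\<close> of a row to the first
  cell \<open>(x, y')\<close> above its column.\<close>

definition dpairs :: "int \<Rightarrow> int \<Rightarrow> int \<Rightarrow> (int \<Rightarrow> int \<Rightarrow> bool) \<Rightarrow> ((int \<times> int) \<times> int \<times> int) set" where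
  "dpairs a b n L = {((x, y), (x', y')). \<not> L x y \<and> L (x - 1) y \<and> L x' y' \<and> \<not> L x' (y' + 1)
     \<and> y \<le> y' \<and> n dvd (a * x + b * y) - (a * x' + b * y')}"

definition upairs :: "int \<Rightarrow> int \<Rightarrow> (int \<Rightarrow> int \<Rightarrow> bool) \<Rightarrow> (int \<times> int \<times> int) set" where
  "upairs b n L = {(x, y, y'). L x y \<and> \<not> L (x + 1) y \<and> \<not> L x y' \<and> L x (y' - 1)
     \<and> n dvd b * (y' - y)}"

text \<open>Both sides say that \<open>(x', y)\<close> is a box. The right side mentions only first
  coordinates, which vertical shifts leave alone.\<close>

lemma outer_inner_order:
  assumes "diagram L" "\<not> L x y" "L (x - 1) y" "L x' y'" "\<not> L x' (y' + 1)"
  shows "y \<le> y' \<longleftrightarrow> x' < x"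
proof
  assume "y \<le> y'"
  then show "x' < x"
    using diagram_down[OF assms(1,4), of x y] diagram_pos[OF assms(1,3)] assms(2) by linarith
next
  assume "x' < x"
  then show "y \<le> y'"
    using diagram_down[OF assms(1,3), of x' "y' + 1"] diagram_pos[OF assms(1,4)] assms(5) by linarith
qed

section \<open>Correspondence of the invariant \<open>d\<close> arrows\<close>

context stretching
begin

lemma col_shift:
  assumes "x < X" "\<delta> \<in> {0, a, b, a + b}"
  shows "M x (y + a * v (a * x + b * y - \<delta>)) = L x y"
proof -
  interpret T: stretching b a n c r Y X v "\<lambda>x y. L y x" "\<lambda>x y. M y x"
    by (rule stretching_transposed)
  show ?thesis using T.row_shift[of x \<delta> y] assms by (auto simp: add.commute)
qed

lemma col_end:
  assumes "x < X" "M x y" "\<not> M x (y + 1)"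
  obtains w where "a * x + b * y = w + a * b * v w"
proof -
  interpret T: stretching b a n c r Y X v "\<lambda>x y. L y x" "\<lambda>x y. M y x"
    by (rule stretching_transposed)
  show ?thesis using T.row_end[OF assms] that by (metis add.commute mult.commute)
qed

text \<open>Levels grow weakly along a row, so the shift is strictly increasing.\<close>

lemma row_shift_inj:
  assumes "x + b * v (a * x + d) = x' + b * v (a * x' + d)"
  shows "x = x'"
proof -
  have False if "x + b * v (a * x + d) = x' + b * v (a * x' + d)" "x < x'" for x x'
  proof -
    have "a * (x' - x) \<in> nspan a b" using that by (intro nspanI[of "x' - x" 0]) auto
    from v_mono[OF this, of "a * x + d"] have "v (a * x + d) \<le> v (a * x' + d)"
      by (simp add: algebra_simps)
    then have "b * v (a * x + d) \<le> b * v (a * x' + d)" using b_pos by simp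
    then show False using that by linarith
  qed
  then show ?thesis using assms by (metis linorder_neqE)
qed

lemma col_shift_inj:
  assumes "y + a * v (b * y + d) = y' + a * v (b * y' + d)"
  shows "y = y'"
proof -
  interpret T: stretching b a n c r Y X v "\<lambda>x y. L y x" "\<lambda>x y. M y x"
    by (rule stretching_transposed)
  show ?thesis using T.row_shift_inj assms by blast
qed

text \<open>For a source beyond the end of a row, the weight less \<open>a\<close> is that of the
  last box of the row, whose level dictates the shift.\<close>

definition outer_shift :: "int \<Rightarrow> int \<Rightarrow> int \<times> int" where
  "outer_shift x y = (if y < Y then (x + b * v (a * x + b * y - a), y)
     else (x, y + a * v (a * x + b * y - a)))"

text \<open>The target reads its level at the same offset \<open>a\<close> as the source, so that
  congruence of the two weights survives.\<close>

definition inner_shift :: "int \<Rightarrow> int \<Rightarrow> int \<times> int" where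
  "inner_shift x y = (if x < X then (x, y + a * v (a * x + b * y - a))
     else (x + b * v (a * x + b * y - a), y))"

lemma v_nonneg_cell: "0 \<le> x \<Longrightarrow> 0 \<le> y \<Longrightarrow> 0 \<le> v (a * x + b * y - a)"
  using weight_nonneg[of x y] b_pos by (intro v_nonneg) simp

lemma v_nonneg_cell_b: "0 \<le> x \<Longrightarrow> 0 \<le> y \<Longrightarrow> 0 \<le> v (a * x + b * y - b)"
  using weight_nonneg[of x y] a_pos by (intro v_nonneg) simp

lemma outer_shift_iff:
  assumes "outer_shift x y = (x', y')"
  shows "\<not> L x y \<and> L (x - 1) y \<longleftrightarrow> \<not> M x' y' \<and> M (x' - 1) y'"
proof (cases "y < Y")
  case True
  have xy: "x' = x + b * v (a * x + b * y - a)" "y' = y"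
    using assms True unfolding outer_shift_def by auto
  have "M x' y' = L x y" using row_shift[OF True, of a x] xy by simp
  moreover have "M (x' - 1) y' = L (x - 1) y"
    using row[OF True, of "x - 1"] xy by (simp add: algebra_simps)
  ultimately show ?thesis by simp
next
  case False
  have xy: "x' = x" "y' = y + a * v (a * x + b * y - a)"
    using assms False unfolding outer_shift_def by auto
  \<comment> \<open>The source may lie in the first column beyond the stretched ones, where both
    diagrams are empty from height \<open>Y\<close> on.\<close>
  have out: "\<not> M x1 y'" if "X \<le> x" "X \<le> x1" for x1
  proof -
    have "Y \<le> y'"
      using a_mult[OF v_nonneg_cell[of x y]] that xy False X_nonneg Y_nonneg by linarith
    then show ?thesis using M_out[of x1 y'] that by simp
  qed
  have "M x y' = L x y"
    using col_shift[of x a y] xy out[of x] L_out[of x y] False by (cases "x < X") auto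
  moreover have "M (x - 1) y' = L (x - 1) y"
  proof (cases "x - 1 < X")
    case True
    then show ?thesis using col[OF True, of y] xy by (simp add: algebra_simps)
  next
    case f: False
    then show ?thesis using out[of "x - 1"] L_out[of "x - 1" y] False by simp
  qed
  ultimately show ?thesis using xy by simp
qed

lemma inner_shift_iff:
  assumes "inner_shift x y = (x', y')"
  shows "L x y \<and> \<not> L x (y + 1) \<longleftrightarrow> M x' y' \<and> \<not> M x' (y' + 1)"
proof (cases "x < X")
  case True
  have xy: "y' = y + a * v (a * x + b * y - a)" "x' = x"
    using assms True unfolding inner_shift_def by auto
  have "M x' y' = L x y" using col_shift[OF True, of a y] xy by simp
  \<comment> \<open>The cell above has weight larger by \<open>b\<close>, so relative to it the
    level is read at offset \<open>a + b\<close>.\<close>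
  moreover have "M x' (y' + 1) = L x (y + 1)"
    using col_shift[OF True, of "a + b" "y + 1"] xy by (simp add: algebra_simps)
  ultimately show ?thesis by simp
next
  case False
  have xy: "x' = x + b * v (a * x + b * y - a)" "y' = y"
    using assms False unfolding inner_shift_def by auto
  show ?thesis
  proof (cases "0 \<le> y")
    case y0: True
    then have x': "X \<le> x'"
      using b_mult[OF v_nonneg_cell[of x y]] False X_nonneg xy by linarith
    have "M x' y' = L x y"
      using row_shift[of y a x] xy x' L_out[of x y] M_out[of x' y'] False by (cases "y < Y") auto
    moreover have "M x' (y' + 1) = L x (y + 1)"
    proof (cases "y + 1 < Y")
      case True
      then show ?thesis
        using row_shift[OF True, of "a + b" x] xy by (simp add: algebra_simps)
    next
      case f: False
      then show ?thesis using x' xy L_out[of x "y + 1"] M_out[of x' "y' + 1"] False by simp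
    qed
    ultimately show ?thesis by simp
  next
    case y0: False
    then show ?thesis using xy diagram_pos[OF L, of x y] diagram_pos[OF M, of x' y'] by auto
  qed
qed

text \<open>If both ends move vertically, their first coordinates are unchanged and
  \<open>outer_inner_order\<close> transports the condition. Otherwise the height of the source is
  kept and the target stays, or rises from a height already at least \<open>Y\<close>, or the target
  would lie beyond the corner.\<close>

lemma shift_order:
  assumes e: "\<not> L x1 y1" "L (x1 - 1) y1" and f: "L x2 y2" "\<not> L x2 (y2 + 1)"
    and e': "outer_shift x1 y1 = (x1', y1')" and f': "inner_shift x2 y2 = (x2', y2')"
  shows "y1 \<le> y2 \<longleftrightarrow> y1' \<le> y2'"
proof -
  have pos: "0 \<le> x1 - 1" "0 \<le> y1" "0 \<le> x2" "0 \<le> y2"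
    using diagram_pos[OF L e(2)] diagram_pos[OF L f(1)] by auto
  have v1: "0 \<le> a * v (a * x1 + b * y1 - a)" and v2: "0 \<le> v (a * x2 + b * y2 - a)"
    using v_nonneg_cell[of x1 y1] v_nonneg_cell[of x2 y2] pos a_mult by auto
  consider "y1 < Y" "X \<le> x2" | "y1 < Y" "x2 < X" "y2 < Y" | "y1 < Y" "x2 < X" "Y \<le> y2"
    | "Y \<le> y1" "X \<le> x2" | "Y \<le> y1" "x2 < X"
    by linarith
  then show ?thesis
  proof cases
    case 1
    then show ?thesis using e' f' unfolding outer_shift_def inner_shift_def by auto
  next
    case 2
    have "v (a * x2 + b * y2 - a) \<le> 0"
      using v_core[OF 2(2,3)] v_le(1)[of "a * x2 + b * y2"] by linarith
    then have "v (a * x2 + b * y2 - a) = 0" using v2 by simp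
    then show ?thesis using e' f' 2 unfolding outer_shift_def inner_shift_def by auto
  next
    case 3
    have "0 \<le> a * v (a * x2 + b * y2 - a)" using v2 a_mult by simp
    then show ?thesis using e' f' 3 unfolding outer_shift_def inner_shift_def by auto
  next
    case 4
    then show ?thesis using e' f' v1 f(1) L_out[of x2 y2]
      unfolding outer_shift_def inner_shift_def by auto
  next
    case 5
    have "\<not> M x1' y1'" "M (x1' - 1) y1'" using outer_shift_iff[OF e'] e by auto
    moreover have "M x2' y2'" "\<not> M x2' (y2' + 1)" using inner_shift_iff[OF f'] f by auto
    ultimately have "y1' \<le> y2' \<longleftrightarrow> x2' < x1'" by (rule outer_inner_order[OF M])
    moreover have "y1 \<le> y2 \<longleftrightarrow> x2 < x1" by (rule outer_inner_order[OF L e f])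
    ultimately show ?thesis using e' f' 5 unfolding outer_shift_def inner_shift_def by auto
  qed
qed

lemma outer_shift_weight:
  "outer_shift x y = (x', y') \<Longrightarrow> a * x' + b * y' = a * x + b * y + a * b * v (a * x + b * y - a)"
  unfolding outer_shift_def by (auto simp: algebra_simps split: if_splits)

lemma inner_shift_weight:
  "inner_shift x y = (x', y') \<Longrightarrow> a * x' + b * y' = a * x + b * y + a * b * v (a * x + b * y - a)"
  unfolding inner_shift_def by (auto simp: algebra_simps split: if_splits)

text \<open>Weights \<open>k * n\<close> apart have levels \<open>k\<close> apart, and
  \<open>k * n + a * b * k = k * (n + a * b)\<close>.\<close>

lemma shifted_weight_dvd:
  assumes "n dvd w1 - w2"
  shows "n + a * b dvd (w1 + a * b * v (w1 - d)) - (w2 + a * b * v (w2 - d))"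
proof -
  obtain k where k: "w1 - w2 = n * k" using assms by blast
  have "v (w1 - d) = v (w2 - d) + k"
  proof -
    have "w1 - d = w2 - d + k * n" using k by (simp add: algebra_simps)
    then show ?thesis using v_shift[of "w2 - d" k] by metis
  qed
  then have "(w1 + a * b * v (w1 - d)) - (w2 + a * b * v (w2 - d)) = (n + a * b) * k"
    using k by (simp add: algebra_simps)
  then show ?thesis by simp
qed

lemma shift_dpairs_iff:
  assumes e': "outer_shift x1 y1 = (x1', y1')" and f': "inner_shift x2 y2 = (x2', y2')"
    and dvd: "n dvd (a * x1 + b * y1) - (a * x2 + b * y2)"
  shows "((x1, y1), (x2, y2)) \<in> dpairs a b n L
    \<longleftrightarrow> ((x1', y1'), (x2', y2')) \<in> dpairs a b (n + a * b) M"
  using outer_shift_iff[OF e'] inner_shift_iff[OF f'] shift_order[OF _ _ _ _ e' f'] dvd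
    shifted_weight_dvd[OF dvd, of a] outer_shift_weight[OF e'] inner_shift_weight[OF f']
  unfolding dpairs_def by auto

text \<open>The shift is undone first at an end known to come from a shifted weight: by
  \<open>row_end\<close> at the source, or by \<open>col_end\<close> at the target. Congruence then
  expresses the weight at the other end through the same \<open>w0\<close>.\<close>

lemma shift_dpairs_surj:
  assumes "((x1', y1'), (x2', y2')) \<in> dpairs a b (n + a * b) M"
  obtains x1 y1 x2 y2 where "outer_shift x1 y1 = (x1', y1')" "inner_shift x2 y2 = (x2', y2')"
    "n dvd (a * x1 + b * y1) - (a * x2 + b * y2)"
proof -
  have p: "\<not> M x1' y1'" "M (x1' - 1) y1'" "M x2' y2'" "\<not> M x2' (y2' + 1)" "y1' \<le> y2'"
    "n + a * b dvd (a * x1' + b * y1') - (a * x2' + b * y2')"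
    using assms unfolding dpairs_def by auto
  show ?thesis
  proof (cases "y1' < Y")
    case True
    obtain k where "(a * x1' + b * y1') - (a * x2' + b * y2') = (n + a * b) * (- k)"
      using p(6) by (metis dvdE minus_minus)
    then have k: "a * x2' + b * y2' = a * x1' + b * y1' + k * (n + a * b)"
      by (simp add: algebra_simps)
    \<comment> \<open>\<open>row_end\<close> concerns the last box of the row; the source is one
      cell further, which accounts for the offset \<open>a\<close>.\<close>
    obtain w0 where "a * (x1' - 1) + b * y1' = w0 + a * b * v w0"
      using row_end[OF True p(2)] p(1) by auto
    then have w0: "a * x1' + b * y1' = w0 + a + a * b * v w0" by (simp add: algebra_simps)
    define x1 where "x1 = x1' - b * v w0"
    have we: "a * x1 + b * y1' = w0 + a" unfolding x1_def using w0 by (simp add: algebra_simps)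
    have E: "outer_shift x1 y1' = (x1', y1')" unfolding outer_shift_def we using True x1_def by simp
    define j where "j = v w0 + k"
    have wf': "a * x2' + b * y2' = w0 + k * n + a + a * b * j"
      using k w0 j_def by (simp add: algebra_simps)
    have vj: "v (w0 + k * n + a - a) = j" using v_shift[of w0 k] j_def by simp
    show ?thesis
    proof (cases "x2' < X")
      case x2: True
      define y2 where "y2 = y2' - a * j"
      have wf: "a * x2' + b * y2 = w0 + k * n + a" unfolding y2_def using wf' by (simp add: algebra_simps)
      have "inner_shift x2' y2 = (x2', y2')"
        unfolding inner_shift_def wf vj using x2 y2_def by simp
      then show ?thesis using that[OF E] we wf by simp
    next
      case x2: False
      define x2 where "x2 = x2' - b * j"
      have wf: "a * x2 + b * y2' = w0 + k * n + a" unfolding x2_def using wf' by (simp add: algebra_simps)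
      have "y2' < Y" using M_out[of x2' y2'] p(3) x2 by linarith
      \<comment> \<open>A positive level excludes the core, so pulling the target back horizontally
        does not cross \<open>X\<close>.\<close>
      then have "x2 < X \<Longrightarrow> v (a * x2 + b * y2') \<le> 0" using v_core by blast
      then have "x2 < X \<Longrightarrow> j \<le> 0" using vj v_le(1)[of "a * x2 + b * y2'"] wf by simp
      then have "\<not> x2 < X" using x2 x2_def b_pos by (smt (verit) mult_nonneg_nonpos)
      then have "inner_shift x2 y2' = (x2', y2')"
        unfolding inner_shift_def wf vj using x2_def by simp
      then show ?thesis using that[OF E] we wf by simp
    qed
  next
    case False
    have x2: "x2' < X" using M_out[of x2' y2'] p(3,5) False by linarith
    have x1: "x1' - 1 < X" using M_out[of "x1' - 1" y1'] p(2) False by linarith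
    obtain w0 where w0: "a * x2' + b * y2' = w0 + a * b * v w0" using col_end[OF x2 p(3,4)] .
    define y2 where "y2 = y2' - a * v w0"
    have wf: "a * x2' + b * y2 = w0" unfolding y2_def using w0 by (simp add: algebra_simps)
    have Lf: "L x2' y2" using col[OF x2, of y2] wf y2_def p(3) by simp
    have "a * x2' + b * (y2 + 1) - b = w0" "y2 + 1 + a * v w0 = y2' + 1"
      using wf unfolding y2_def by (simp_all add: algebra_simps)
    then have Lf1: "\<not> L x2' (y2 + 1)" using col_shift[OF x2, of b "y2 + 1"] p(4)
      by (metis insertI1 insertI2)
    have pos: "0 \<le> x2'" "0 \<le> y2" using diagram_pos[OF L Lf] by auto
    \<comment> \<open>\<open>col_end\<close> supplies the level at \<open>w0\<close>, but
      \<open>inner_shift\<close> reads it at \<open>w0 - a\<close>. They could differ only fewer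
      than \<open>a\<close> steps above a cell of weight \<open>c + m * n\<close>, and there
      straightness would put another box on top of the column.\<close>
    have veq: "v (w0 - a) = v w0"
    proof (rule ccontr)
      define m where "m = v (w0 - a)"
      assume "v (w0 - a) \<noteq> v w0"
      then have vm: "v w0 = m + 1" using v_le(1)[of w0] v_ge(1)[of w0] m_def by simp
      have m0: "0 \<le> m" using v_nonneg_cell[OF pos] wf m_def by simp
      have "m < v w0" using vm by simp
      then have "w0 - c - m * n \<in> nspan a b" unfolding v_iff .
      then obtain i t where it: "0 \<le> i" "0 \<le> t" "w0 - c - m * n = a * i + b * t" by (rule nspanE)
      have "\<not> m < v (w0 - a)" unfolding m_def by simp
      then have no: "a * i + b * t - a \<notin> nspan a b" unfolding v_iff using it by (simp add: algebra_simps)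
      have i0: "i = 0"
      proof (rule ccontr)
        assume "i \<noteq> 0"
        then show False using no it by (auto intro!: nspanI[of "i - 1" t] simp: algebra_simps)
      qed
      have ta: "t < a"
      proof (rule ccontr)
        assume "\<not> t < a"
        then show False
          using no it b_pos i0 by (auto intro!: nspanI[of "b - 1" "t - a"] simp: algebra_simps)
      qed
      have wq: "a * x2' + b * (y2 - t) = c + m * n" using it i0 wf by (simp add: algebra_simps)
      have "v (a * x2' + b * (y2 - t)) = m + 1" using v_block_a[of 0 m] b_pos wq by simp
      then have "Y \<le> y2 - t" using v_col[OF x2, of "y2 - t"] m0 by simp
      then have yt: "0 \<le> y2 - t" using Y_nonneg by simp
      have "L x2' (y2 - t)" by (rule diagram_down[OF L Lf]) (use pos it yt in auto)
      from col_straight[OF x2 wq this] have "L x2' (y2 - t + a)" .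
      then have "L x2' (y2 + 1)" by (rule diagram_down[OF L]) (use pos ta in auto)
      then show False using Lf1 by simp
    qed
    have F: "inner_shift x2' y2 = (x2', y2')"
      unfolding inner_shift_def wf veq using x2 y2_def by simp
    obtain k where "(a * x1' + b * y1') - (a * x2' + b * y2') = (n + a * b) * k"
      using p(6) by blast
    then have k: "a * x1' + b * y1' = w0 + k * n + a * b * (v w0 + k)"
      using w0 by (simp add: algebra_simps)
    define y1 where "y1 = y1' - a * (v w0 + k)"
    have we: "a * x1' + b * y1 = w0 + k * n" unfolding y1_def using k by (simp add: algebra_simps)
    have vj: "v (w0 + k * n - a) = v w0 + k"
      using v_shift[of "w0 - a" k] veq by (simp add: algebra_simps)
    have "Y \<le> y1"
    proof (rule ccontr)
      assume "\<not> Y \<le> y1"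
      then have "v (a * (x1' - 1) + b * y1) \<le> 0" using v_core[OF x1] by simp
      then have "v w0 + k \<le> 0" using vj we by (simp add: algebra_simps)
      then have "a * (v w0 + k) \<le> 0" using a_pos by (simp add: mult_nonneg_nonpos)
      then show False using y1_def False \<open>\<not> Y \<le> y1\<close> by linarith
    qed
    then have "outer_shift x1' y1 = (x1', y1')"
      unfolding outer_shift_def we vj using y1_def by simp
    then show ?thesis using that[OF _ F] we wf by simp
  qed
qed

lemma outer_shift_inj:
  assumes "L (x - 1) y" "L (x' - 1) y'" "outer_shift x y = outer_shift x' y'"
  shows "x = x' \<and> y = y'"
proof -
  have "0 \<le> a * v (a * x + b * y - a)" if "L (x - 1) y" for x y
    using diagram_pos[OF L that] v_nonneg_cell[of x y] a_mult by simp
  from this[OF assms(1)] this[OF assms(2)] have "(y < Y) = (y' < Y)"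
    using assms(3) unfolding outer_shift_def by (auto split: if_splits)
  then show ?thesis
    using assms(3) row_shift_inj[of x "b * y - a" x'] col_shift_inj[of y "a * x - a" y']
    unfolding outer_shift_def by (auto split: if_splits simp: algebra_simps)
qed

lemma inner_shift_inj:
  assumes "L x y" "L x' y'" "inner_shift x y = inner_shift x' y'"
  shows "x = x' \<and> y = y'"
proof -
  have "0 \<le> b * v (a * x + b * y - a)" if "L x y" for x y
    using diagram_pos[OF L that] v_nonneg_cell[of x y] b_mult by simp
  from this[OF assms(1)] this[OF assms(2)] have "(x < X) = (x' < X)"
    using assms(3) unfolding inner_shift_def by (auto split: if_splits)
  then show ?thesis
    using assms(3) row_shift_inj[of x "b * y - a" x'] col_shift_inj[of y "a * x - a" y']
    unfolding inner_shift_def by (auto split: if_splits simp: algebra_simps)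
qed

lemma card_dpairs: "card (dpairs a b (n + a * b) M) = card (dpairs a b n L)"
proof -
  define F where "F = (\<lambda>((x, y), (x', y')). (outer_shift x y, inner_shift x' y'))"
  have "inj_on F (dpairs a b n L)"
  proof (rule inj_onI)
    fix p q assume pq: "p \<in> dpairs a b n L" "q \<in> dpairs a b n L" "F p = F q"
    obtain x1 y1 x2 y2 where p: "p = ((x1, y1), (x2, y2))" by (metis surj_pair)
    obtain u1 z1 u2 z2 where q: "q = ((u1, z1), (u2, z2))" by (metis surj_pair)
    show "p = q"
      using pq outer_shift_inj[of x1 y1 u1 z1] inner_shift_inj[of x2 y2 u2 z2]
      unfolding p q F_def dpairs_def by auto
  qed
  moreover have "F ` dpairs a b n L = dpairs a b (n + a * b) M"
  proof (intro equalityI subsetI)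
    fix q assume "q \<in> F ` dpairs a b n L"
    then obtain p where pq: "p \<in> dpairs a b n L" "q = F p" by blast
    obtain x1 y1 x2 y2 where p: "p = ((x1, y1), (x2, y2))" by (metis surj_pair)
    obtain x1' y1' where e: "outer_shift x1 y1 = (x1', y1')" by fastforce
    obtain x2' y2' where f: "inner_shift x2 y2 = (x2', y2')" by fastforce
    have "n dvd (a * x1 + b * y1) - (a * x2 + b * y2)" using pq p unfolding dpairs_def by simp
    from shift_dpairs_iff[OF e f this] show "q \<in> dpairs a b (n + a * b) M"
      using pq p e f unfolding F_def by simp
  next
    fix q assume q: "q \<in> dpairs a b (n + a * b) M"
    obtain x1' y1' x2' y2' where q': "q = ((x1', y1'), (x2', y2'))" by (metis surj_pair)
    obtain x1 y1 x2 y2 where s: "outer_shift x1 y1 = (x1', y1')" "inner_shift x2 y2 = (x2', y2')"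
      "n dvd (a * x1 + b * y1) - (a * x2 + b * y2)"
      using shift_dpairs_surj q unfolding q' by blast
    have "((x1, y1), (x2, y2)) \<in> dpairs a b n L" using shift_dpairs_iff[OF s] q unfolding q' by simp
    moreover have "q = F ((x1, y1), (x2, y2))" using s unfolding F_def q' by simp
    ultimately show "q \<in> F ` dpairs a b n L" by blast
  qed
  ultimately show ?thesis using card_image by metis
qed

end

text \<open>An invariant vertical arrow has length at least \<open>N / b\<close>, which exceeds
  \<open>r * a \<ge> Y\<close>. Its column therefore rises above the corner, and only column shifts
  are needed for these arrows.\<close>

lemma (in corner) upairs_col:
  assumes L: "diagram L" "\<not> L X Y" and "n \<le> N" "(x, y, y') \<in> upairs b N L"
  shows "x < X"
proof -
  have p: "L x y" "\<not> L x y'" "L x (y' - 1)" "N dvd b * (y' - y)"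
    using assms(4) unfolding upairs_def by auto
  have pos: "0 \<le> x" "0 \<le> y" "0 \<le> y' - 1" using diagram_pos[OF L(1)] p by blast+
  have "y < y'" using diagram_down[OF L(1) p(1), of x y'] p(2) pos by linarith
  then have "N \<le> b * (y' - y)" using p(4) b_pos by (intro zdvd_imp_le) auto
  then have "b * (r * a) < b * (y' - y)" using n_gt assms(3) by (simp add: algebra_simps)
  then have "r * a < y' - y" using b_pos by simp
  then have "Y \<le> y' - 1" using Y_le pos by linarith
  then show "x < X"
    using diagram_down[OF L(1) p(3), of X Y] L(2) X_nonneg Y_nonneg by linarith
qed

section \<open>Correspondence of the vertical \<open>u\<close> arrows\<close>

context stretching
begin

text \<open>The right neighbour has weight larger by \<open>a\<close>, so its offset is
  \<open>a + b\<close>. If it lies beyond the stretched columns but in a row below \<open>Y\<close>,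
  the box itself is in the core and does not move.\<close>

lemma shift_row_end_iff:
  assumes "x < X" "L x y"
  shows "M (x + 1) (y + a * v (a * x + b * y - b)) = L (x + 1) y"
proof -
  define w where "w = a * x + b * y"
  have pos: "0 \<le> x" "0 \<le> y" using diagram_pos[OF L assms(2)] by auto
  have v0: "0 \<le> v (w - b)" using v_nonneg_cell_b[OF pos] w_def by simp
  have w1: "a * (x + 1) + b * y - (a + b) = w - b" "a * (x + 1) + b * y - a = w"
    unfolding w_def by (simp_all add: algebra_simps)
  consider "x + 1 < X" | "X \<le> x + 1" "Y \<le> y" | "X \<le> x + 1" "y < Y" by linarith
  then have "M (x + 1) (y + a * v (w - b)) = L (x + 1) y"
  proof cases
    case 1
    then show ?thesis using col_shift[OF 1, of "a + b" y] w1(1) by simp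
  next
    case 2
    then have "Y \<le> y + a * v (w - b)" using a_mult[OF v0] by linarith
    then show ?thesis using 2 L_out M_out by blast
  next
    case 3
    have "v w \<le> 0" using v_core[OF assms(1) 3(2)] w_def by simp
    then have "v w = 0" "v (w - b) = 0" using v0 v_le(2)[of w] by auto
    then show ?thesis using row_shift[OF 3(2), of a "x + 1"] w1(2) by simp
  qed
  then show ?thesis unfolding w_def .
qed

lemma shift_upairs_iff:
  assumes x: "x < X" and dvd: "n dvd b * (y2 - y1)"
    and y1': "y1' = y1 + a * v (a * x + b * y1 - b)"
    and y2': "y2' = y2 + a * v (a * x + b * y2 - b)"
  shows "(x, y1, y2) \<in> upairs b n L \<longleftrightarrow> (x, y1', y2') \<in> upairs b (n + a * b) M"
proof -
  have "M x y1' = L x y1" "M x y2' = L x y2"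
    using col_shift[OF x, of b] unfolding y1' y2' by auto
  moreover have "M x (y2' - 1) = L x (y2 - 1)"
    using col[OF x, of "y2 - 1"] unfolding y2' by (simp add: algebra_simps)
  moreover have "L x y1 \<Longrightarrow> M (x + 1) y1' = L (x + 1) y1"
    using shift_row_end_iff[OF x] unfolding y1' .
  moreover have "n + a * b dvd b * (y2' - y1')"
  proof -
    have "n dvd (a * x + b * y2) - (a * x + b * y1)" using dvd by (simp add: algebra_simps)
    from shifted_weight_dvd[OF this, of b] show ?thesis
      unfolding y1' y2' by (simp add: algebra_simps)
  qed
  ultimately show ?thesis using dvd unfolding upairs_def by auto
qed

text \<open>The column ends at \<open>(x, y2' - 1)\<close>, so \<open>col_end\<close> gives the
  level there; the offset \<open>b\<close> refers to this last box.\<close>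

lemma shift_upairs_surj:
  assumes "(x, y1', y2') \<in> upairs b (n + a * b) M" and x: "x < X"
  obtains y1 y2 where "n dvd b * (y2 - y1)" "y1' = y1 + a * v (a * x + b * y1 - b)"
    "y2' = y2 + a * v (a * x + b * y2 - b)"
proof -
  have p: "\<not> M x y2'" "M x (y2' - 1)" "n + a * b dvd b * (y2' - y1')"
    using assms unfolding upairs_def by auto
  obtain w0 where "a * x + b * (y2' - 1) = w0 + a * b * v w0"
    using col_end[OF x p(2)] p(1) by auto
  then have w0: "a * x + b * y2' = w0 + b + a * b * v w0" by (simp add: algebra_simps)
  define y2 where "y2 = y2' - a * v w0"
  have w2: "a * x + b * y2 = w0 + b" unfolding y2_def using w0 by (simp add: algebra_simps)
  obtain k where "b * (y2' - y1') = (n + a * b) * (- k)" using p(3) by (metis dvdE minus_minus)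
  then have k: "a * x + b * y1' = w0 + k * n + b + a * b * (v w0 + k)"
    using w0 by (simp add: algebra_simps)
  define y1 where "y1 = y1' - a * (v w0 + k)"
  have w1: "a * x + b * y1 = w0 + k * n + b" unfolding y1_def using k by (simp add: algebra_simps)
  have "b * (y2 - y1) = n * (- k)" using w1 w2 by (simp add: algebra_simps)
  then have "n dvd b * (y2 - y1)" by simp
  moreover have "y1' = y1 + a * v (a * x + b * y1 - b)" "y2' = y2 + a * v (a * x + b * y2 - b)"
    unfolding w1 w2 using v_shift[of w0 k] y1_def y2_def by simp_all
  ultimately show ?thesis using that by blast
qed

lemma card_upairs: "card (upairs b (n + a * b) M) = card (upairs b n L)"
proof -
  define f where "f = (\<lambda>x y. y + a * v (a * x + b * y - b))"
  define F where "F = (\<lambda>(x, y1, y2). (x, f x y1, f x y2))"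
  have f_inj: "f x y = f x z \<Longrightarrow> y = z" for x y z
    using col_shift_inj[of y "a * x - b" z] unfolding f_def by (simp add: algebra_simps)
  then have "inj_on F (upairs b n L)" unfolding F_def inj_on_def by auto
  moreover have "F ` upairs b n L = upairs b (n + a * b) M"
  proof (intro equalityI subsetI)
    fix q assume "q \<in> F ` upairs b n L"
    then obtain x y1 y2 where p: "(x, y1, y2) \<in> upairs b n L" "q = F (x, y1, y2)" by auto
    have x: "x < X" by (rule upairs_col[OF L L_corner _ p(1)]) simp
    have "n dvd b * (y2 - y1)" using p(1) unfolding upairs_def by simp
    from shift_upairs_iff[OF x this refl refl] show "q \<in> upairs b (n + a * b) M"
      using p unfolding F_def f_def by simp
  next
    fix q assume q: "q \<in> upairs b (n + a * b) M"
    obtain x y1' y2' where q': "q = (x, y1', y2')" by (metis surj_pair)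
    have x: "x < X" by (rule upairs_col[OF M M_corner _ q[unfolded q']]) (use ab_pos in simp)
    obtain y1 y2 where s: "n dvd b * (y2 - y1)" "y1' = y1 + a * v (a * x + b * y1 - b)"
      "y2' = y2 + a * v (a * x + b * y2 - b)"
      using shift_upairs_surj[OF q[unfolded q'] x] .
    have "(x, y1, y2) \<in> upairs b n L" using shift_upairs_iff[OF x s] q unfolding q' by simp
    moreover have "q = F (x, y1, y2)" using s unfolding F_def f_def q' by simp
    ultimately show "q \<in> F ` upairs b n L" by blast
  qed
  ultimately show ?thesis using card_image by metis
qed

text \<open>The shift \<open>h\<close> of boxes is injective, and \<open>shifted_weight_dvd\<close>
  with offset 0 matches the classes. Positive levels occur only outside the core, so undoing a shift
  leads neither from a row nor from a column into the other region.\<close>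

lemma card_shifted_class:
  "card {(x, y). M x y \<and> n + a * b dvd a * x + b * y - (w + a * b * v w)}
    = card {(x, y). L x y \<and> n dvd a * x + b * y - w}"
proof -
  define h where "h = (\<lambda>x y. if y < Y then (x + b * v (a * x + b * y), y)
    else (x, y + a * v (a * x + b * y)))"
  define P where "P = {(x, y). L x y \<and> n dvd a * x + b * y - w}"
  define Q where "Q = {(x, y). M x y \<and> n + a * b dvd a * x + b * y - (w + a * b * v w)}"
  have nn: "0 \<le> v (a * x + b * y)" if "L x y" for x y
    by (rule v_nonneg) (use diagram_pos[OF L that] weight_nonneg[of x y] a_pos b_pos in linarith)
  have "inj_on (case_prod h) P"
  proof (rule inj_onI, clarify)
    fix x y x' y' assume p: "(x, y) \<in> P" "(x', y') \<in> P" "h x y = h x' y'"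
    have "0 \<le> a * v (a * x + b * y)" "0 \<le> a * v (a * x' + b * y')"
      using p nn a_mult unfolding P_def by auto
    then have "(y < Y) = (y' < Y)" using p(3) unfolding h_def by (auto split: if_splits)
    then show "x = x' \<and> y = y'"
      using p(3) row_shift_inj[of x "b * y" x'] col_shift_inj[of y "a * x" y']
      unfolding h_def by (auto split: if_splits simp: algebra_simps)
  qed
  moreover have "case_prod h ` P = Q"
  proof (intro equalityI subsetI)
    fix q assume "q \<in> case_prod h ` P"
    then obtain x y where p: "L x y" "n dvd a * x + b * y - w" "q = h x y" unfolding P_def by auto
    obtain x' y' where q: "h x y = (x', y')" by fastforce
    have "M x' y'"
    proof (cases "y < Y")
      case True
      then show ?thesis using q row[OF True, of x] p(1) unfolding h_def by auto
    next
      case False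
      then have "x < X" using L_out p(1) not_le by blast
      then show ?thesis using q col[of x y] p(1) False unfolding h_def by auto
    qed
    moreover have "a * x' + b * y' = a * x + b * y + a * b * v (a * x + b * y)"
      using q unfolding h_def by (auto simp: algebra_simps split: if_splits)
    ultimately show "q \<in> Q" using shifted_weight_dvd[OF p(2), of 0] p(3) q unfolding Q_def by simp
  next
    fix q assume q: "q \<in> Q"
    obtain x' y' where q': "q = (x', y')" by (cases q)
    have Mq: "M x' y'" using q unfolding Q_def q' by simp
    obtain k where "a * x' + b * y' - (w + a * b * v w) = (n + a * b) * k"
      using q unfolding Q_def q' by blast
    then have k: "a * x' + b * y' = w + k * n + a * b * (v w + k)" by (simp add: algebra_simps)
    define j where "j = v w + k"
    have vj: "v (w + k * n) = j" using v_shift j_def by simp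
    show "q \<in> case_prod h ` P"
    proof (cases "y' < Y")
      case True
      have wx: "a * (x' - b * j) + b * y' = w + k * n" unfolding j_def using k by (simp add: algebra_simps)
      then have "L (x' - b * j) y'" using row[OF True, of "x' - b * j"] vj Mq by simp
      moreover have "h (x' - b * j) y' = q" unfolding h_def wx vj q' using True by simp
      moreover have "n dvd a * (x' - b * j) + b * y' - w" unfolding wx by simp
      ultimately have "(x' - b * j, y') \<in> P" "q = case_prod h (x' - b * j, y')"
        unfolding P_def by simp_all
      then show ?thesis by blast
    next
      case False
      have x: "x' < X" using M_out[of x' y'] Mq False by linarith
      have wx: "a * x' + b * (y' - a * j) = w + k * n" unfolding j_def using k by (simp add: algebra_simps)
      have "\<not> y' - a * j < Y"
      proof
        assume y: "y' - a * j < Y"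
        then have "j \<le> 0" using v_core[OF x y] wx vj by simp
        then have "a * j \<le> 0" using a_pos by (simp add: mult_nonneg_nonpos)
        then show False using y False by linarith
      qed
      moreover have "L x' (y' - a * j)" using col[OF x, of "y' - a * j"] wx vj Mq by simp
      moreover from calculation have "h x' (y' - a * j) = q" unfolding h_def wx vj q' by simp
      moreover have "n dvd a * x' + b * (y' - a * j) - w" unfolding wx by simp
      ultimately have "(x', y' - a * j) \<in> P" "q = case_prod h (x', y' - a * j)"
        unfolding P_def by simp_all
      then show ?thesis by blast
    qed
  qed
  ultimately have "card Q = card P" using card_image[of "case_prod h" P] by simp
  then show ?thesis unfolding P_def Q_def .
qed

text \<open>By \<open>weight_cases\<close> each cell with \<open>y < Y\<close> or
  \<open>x < X\<close> is the image of a cell or belongs to a block, so its value is prescribed;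
  beyond the corner there are no boxes.\<close>

lemma M_determined:
  assumes "stretching a b n c r X Y v L M'"
  shows "M' = M"
proof -
  interpret S: stretching a b n c r X Y v L M' by (rule assms)
  have "M' x y = M x y" if y: "y < Y" for x y
  proof (cases rule: weight_cases[of "a * x + b * y"])
    case (shifted w)
    then have "a * (x - b * v w) + b * y = w" by (simp add: algebra_simps)
    then show ?thesis using row[OF y, of "x - b * v w"] S.row[OF y, of "x - b * v w"] by simp
  next
    case (block m i t)
    then have p: "a * (x - b * m - i) + b * y = c + m * n + b * t" by (simp add: algebra_simps)
    then show ?thesis
      using row_block[OF y p block(3,4,1,2)] S.row_block[OF y p block(3,4,1,2)] by simp
  qed
  moreover have "M' x y = M x y" if x: "x < X" for x y
  proof (cases rule: weight_cases[of "a * x + b * y"])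
    case (shifted w)
    then have "a * x + b * (y - a * v w) = w" by (simp add: algebra_simps)
    then show ?thesis using col[OF x, of "y - a * v w"] S.col[OF x, of "y - a * v w"] by simp
  next
    case (block m i t)
    then have p: "a * x + b * (y - a * m - t) = c + m * n + a * i" by (simp add: algebra_simps)
    then show ?thesis
      using col_block[OF x p block(1-4)] S.col_block[OF x p block(1-4)] by simp
  qed
  ultimately have "M' x y = M x y" for x y
    using M_out[of x y] S.M_out[of x y] by (meson not_le)
  then show ?thesis by blast
qed

lemma L_determined:
  assumes "stretching a b n c r X Y v L' M"
  shows "L' = L"
proof -
  interpret S: stretching a b n c r X Y v L' M by (rule assms)
  have "L' x y = L x y" if y: "y < Y" for x y using row[OF y] S.row[OF y] by metis
  moreover have "L' x y = L x y" if x: "x < X" for x y using col[OF x] S.col[OF x] by metis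
  ultimately have "L' x y = L x y" for x y
    using L_out[of x y] S.L_out[of x y] by (meson not_le)
  then show ?thesis by blast
qed

end

section \<open>Equidistribution under stretching\<close>

context stretching
begin

text \<open>The cell \<open>(x - b, y)\<close> has weight \<open>c\<close> and level 1, so it moves
  exactly onto \<open>(x, y)\<close>, and straightness identifies the two positions in
  \<open>L\<close>. This keeps the choice of corner the same for \<open>L\<close> and
  \<open>M\<close>.\<close>

lemma rim_agree:
  assumes "y < Y" "a * x + b * y = c + a * b"
  shows "M x y = L x y"
proof -
  have w: "a * (x - b) + b * y = c + 0 * n" using assms(2) by (simp add: algebra_simps)
  have v: "v (a * (x - b) + b * y) = 1" using v_block_a[of 0 0] b_pos w by simp
  have x: "0 \<le> x - b" using v_row[OF assms(1), of "x - b"] v X_nonneg by simp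
  have "M x y = L (x - b) y" using row[OF assms(1), of "x - b"] v by simp
  moreover have "L (x - b) y \<Longrightarrow> L x y" using row_straight[OF assms(1) w] by simp
  moreover have "L (x - b) y" if "L x y"
    by (rule diagram_down[OF L that]) (use x b_pos diagram_pos[OF L that] in auto)
  ultimately show ?thesis by blast
qed

lemma class_level:
  assumes "0 \<le> x" "0 \<le> y" "a * x + b * y = c + \<sigma> + j * n" "c + \<sigma> < n"
  shows "0 \<le> j"
proof (rule mult_nonneg_if)
  show "0 \<le> c + \<sigma> + j * n" using weight_nonneg[OF assms(1,2)] assms(3) by simp
qed (rule assms(4))

text \<open>Each row box of color \<open>c + b * t\<close> generates one block, and \<open>h\<close>
  sends it to copy number \<open>i\<close>. The block sits one level below the image of the box
  itself, hence the term \<open>- b\<close>.\<close>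

lemma card_row_block:
  assumes "0 \<le> i" "i < b" "0 \<le> t" "t < a"
  shows "card {(x, y). M x y \<and> y < Y \<and> n + a * b dvd a * x + b * y - (c + m * (n + a * b) + a * i + b * t)}
    = card {(x, y). L x y \<and> y < Y \<and> n dvd a * x + b * y - (c + b * t)}"
proof -
  define P where "P = {(x, y). L x y \<and> y < Y \<and> n dvd a * x + b * y - (c + b * t)}"
  define Q where "Q = {(x, y). M x y \<and> y < Y
    \<and> n + a * b dvd a * x + b * y - (c + m * (n + a * b) + a * i + b * t)}"
  define h where "h = (\<lambda>(x, y). (x + b * v (a * x + b * y) - b + i, y))"
  have "inj_on h P"
  proof (rule inj_onI, clarify)
    fix x y x' y' assume "h (x, y) = h (x', y')"
    then show "x = x' \<and> y = y'"
      using row_shift_inj[of x "b * y" x'] unfolding h_def by auto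
  qed
  moreover have "h ` P = Q"
  proof (intro equalityI subsetI)
    fix q assume "q \<in> h ` P"
    then obtain x y where p: "L x y" "y < Y" "n dvd a * x + b * y - (c + b * t)" "q = h (x, y)"
      unfolding P_def by auto
    obtain j where "a * x + b * y - (c + b * t) = n * j" using p(3) by blast
    then have j: "a * x + b * y = c + j * n + b * t" by (simp add: algebra_simps)
    have "v (a * x + b * y) = j + 1" unfolding j using v_block_b assms by simp
    then have q: "q = (x + b * j + i, y)" using p(4) unfolding h_def by (simp add: algebra_simps)
    have "a * (x + b * j + i) + b * y - (c + m * (n + a * b) + a * i + b * t) = (n + a * b) * (j - m)"
      using j by (simp add: algebra_simps)
    then have "n + a * b dvd a * (x + b * j + i) + b * y - (c + m * (n + a * b) + a * i + b * t)"
      by simp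
    then show "q \<in> Q" unfolding q Q_def using row_block[OF p(2) j] assms p by simp
  next
    fix q assume q: "q \<in> Q"
    obtain x y where xy: "q = (x, y)" by (cases q)
    obtain k where "a * x + b * y - (c + m * (n + a * b) + a * i + b * t) = (n + a * b) * k"
      using q unfolding Q_def xy by blast
    then have k: "a * (x - b * (m + k) - i) + b * y = c + (m + k) * n + b * t"
      by (simp add: algebra_simps)
    have y: "y < Y" "M x y" using q unfolding Q_def xy by auto
    have "L (x - b * (m + k) - i) y" using row_block[OF y(1) k assms(3,4,1,2)] y(2) by simp
    moreover have "n dvd a * (x - b * (m + k) - i) + b * y - (c + b * t)" unfolding k by simp
    moreover have "v (a * (x - b * (m + k) - i) + b * y) = m + k + 1"
      unfolding k using v_block_b assms by simp
    ultimately have "(x - b * (m + k) - i, y) \<in> P" "h (x - b * (m + k) - i, y) = q"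
      using y(1) unfolding P_def h_def xy by (auto simp: distrib_left)
    then show "q \<in> h ` P" by blast
  qed
  ultimately have "card Q = card P" using card_image[of h P] by simp
  then show ?thesis unfolding P_def Q_def .
qed

text \<open>By straightness, a row containing a cell of weight \<open>c + j * n\<close> contains the
  next \<open>b\<close> cells too; down-closure gives the way back.\<close>

lemma card_row_class:
  assumes "0 \<le> i" "i < b"
  shows "card {(x, y). L x y \<and> y < Y \<and> n dvd a * x + b * y - (c + a * i)}
    = card {(x, y). L x y \<and> y < Y \<and> n dvd a * x + b * y - c}"
proof -
  define P where "P = {(x, y). L x y \<and> y < Y \<and> n dvd a * x + b * y - c}"
  define Q where "Q = {(x, y). L x y \<and> y < Y \<and> n dvd a * x + b * y - (c + a * i)}"
  define h where "h = (\<lambda>(x::int, y::int). (x + i, y))"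
  have "inj_on h P" unfolding h_def by (auto simp: inj_on_def)
  moreover have "h ` P = Q"
  proof (intro equalityI subsetI)
    fix q assume "q \<in> h ` P"
    then obtain x y where p: "L x y" "y < Y" "n dvd a * x + b * y - c" "q = (x + i, y)"
      unfolding P_def h_def by auto
    obtain j where "a * x + b * y - c = n * j" using p(3) by blast
    then have j: "a * x + b * y = c + j * n" by (simp add: algebra_simps)
    have "L (x + b) y" by (rule row_straight[OF p(2) j p(1)])
    then have "L (x + i) y"
      by (rule diagram_down[OF L]) (use assms diagram_pos[OF L p(1)] in auto)
    moreover have "a * (x + i) + b * y - (c + a * i) = n * j" using j by (simp add: algebra_simps)
    ultimately show "q \<in> Q" using p unfolding Q_def by simp
  next
    fix q assume q: "q \<in> Q"
    obtain x y where xy: "q = (x, y)" by (cases q)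
    have p: "L x y" "y < Y" "n dvd a * x + b * y - (c + a * i)" using q unfolding Q_def xy by auto
    have pos: "0 \<le> x" "0 \<le> y" using diagram_pos[OF L p(1)] by auto
    obtain j where "a * x + b * y - (c + a * i) = n * j" using p(3) by blast
    then have j: "a * x + b * y = c + a * i + j * n" by (simp add: algebra_simps)
    have "c + a * i < n" using a_mult_less[OF assms(2)] c_ab by linarith
    then have j0: "0 \<le> j" using class_level[OF pos j] by simp
    have w: "a * (x - i) + b * y = c + j * n" using j by (simp add: algebra_simps)
    have "v (a * (x - i) + b * y) = j + 1" using v_block_a[of 0 j] b_pos w by simp
    then have "0 \<le> x - i" using v_row[OF p(2), of "x - i"] j0 X_nonneg by linarith
    then have "L (x - i) y" by (intro diagram_down[OF L p(1)]) (use assms pos in auto)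
    moreover have "n dvd a * (x - i) + b * y - c" unfolding w by simp
    ultimately have "(x - i, y) \<in> P" "q = h (x - i, y)" using p(2) unfolding P_def h_def xy by auto
    then show "q \<in> h ` P" by blast
  qed
  ultimately have "card Q = card P" using card_image[of h P] by simp
  then show ?thesis unfolding P_def Q_def .
qed

text \<open>Rows and columns overlap only in the core, which \<open>level_pos\<close> excludes for
  these weights.\<close>

lemma card_class_split:
  assumes "\<sigma> \<in> nspan a b" "c + \<sigma> < n"
  shows "card {(x, y). L x y \<and> n dvd a * x + b * y - (c + \<sigma>)}
    = card {(x, y). L x y \<and> y < Y \<and> n dvd a * x + b * y - (c + \<sigma>)}
      + card {(x, y). L x y \<and> x < X \<and> n dvd a * x + b * y - (c + \<sigma>)}"
proof -
  define A where "A = {(x, y). L x y \<and> y < Y \<and> n dvd a * x + b * y - (c + \<sigma>)}"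
  define B where "B = {(x, y). L x y \<and> x < X \<and> n dvd a * x + b * y - (c + \<sigma>)}"
  have "finite A" "finite B"
    unfolding A_def B_def by (auto intro!: finite_subset[OF _ diagram_finite[OF L]])
  moreover have "False" if "(x, y) \<in> A" "(x, y) \<in> B" for x y
  proof -
    have p: "L x y" "x < X" "y < Y" "n dvd a * x + b * y - (c + \<sigma>)"
      using that unfolding A_def B_def by auto
    obtain j where "a * x + b * y - (c + \<sigma>) = n * j" using p(4) by blast
    then have j: "a * x + b * y = c + \<sigma> + j * n" by (simp add: algebra_simps)
    have "0 \<le> j" using class_level[OF _ _ j assms(2)] diagram_pos[OF L p(1)] by simp
    then show False using level_pos(1)[OF assms(1) _ j p(2)] p(3) by simp
  qed
  then have "A \<inter> B = {}" by auto
  ultimately have "card (A \<union> B) = card A + card B" by (rule card_Un_disjoint)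
  moreover have "A \<union> B = {(x, y). L x y \<and> n dvd a * x + b * y - (c + \<sigma>)}"
    using L_out unfolding A_def B_def by (auto simp: not_less) (meson not_le)
  ultimately show ?thesis unfolding A_def B_def by simp
qed

lemma card_block_split:
  fixes m :: int
  assumes "0 \<le> i" "i < b" "0 \<le> t" "t < a"
  defines "k \<equiv> c + m * (n + a * b) + a * i + b * t"
  shows "card {(x, y). M x y \<and> n + a * b dvd a * x + b * y - k}
    = card {(x, y). M x y \<and> y < Y \<and> n + a * b dvd a * x + b * y - k}
      + card {(x, y). M x y \<and> x < X \<and> n + a * b dvd a * x + b * y - k}"
proof -
  define A where "A = {(x, y). M x y \<and> y < Y \<and> n + a * b dvd a * x + b * y - k}"
  define B where "B = {(x, y). M x y \<and> x < X \<and> n + a * b dvd a * x + b * y - k}"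
  have "finite A" "finite B"
    unfolding A_def B_def by (auto intro!: finite_subset[OF _ diagram_finite[OF M]])
  moreover have "False" if "(x, y) \<in> A" "(x, y) \<in> B" for x y
  proof -
    have p: "M x y" "x < X" "y < Y" "n + a * b dvd a * x + b * y - k"
      using that unfolding A_def B_def by auto
    obtain j where "a * x + b * y - k = (n + a * b) * (j - m)" using p(4)
      by (metis add_diff_cancel_right' dvdE)
    then have j: "a * x + b * y = c + j * (n + a * b) + a * i + b * t"
      unfolding k_def by (simp add: algebra_simps)
    have w: "a * (x - b * j - i) + b * y = c + j * n + b * t" using j by (simp add: algebra_simps)
    have Lp: "L (x - b * j - i) y" using row_block[OF p(3) w assms(3,4,1,2)] p(1) by simp
    have "a * (x - b * j - i) + b * y = c + b * t + j * n" using w by simp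
    moreover have "c + b * t < n" using b_mult_less[OF assms(4)] c_ab by linarith
    ultimately have j0: "0 \<le> j" using class_level diagram_pos[OF L Lp] by blast
    have "v (a * (x - b * j - i) + b * y) = j + 1" unfolding w using v_block_b assms by simp
    then have "X \<le> x - b * j - i" using v_row[OF p(3), of "x - b * j - i"] j0 by simp
    then show False using b_mult[OF j0] assms(1) p(2) by simp
  qed
  then have "A \<inter> B = {}" by auto
  ultimately have "card (A \<union> B) = card A + card B" by (rule card_Un_disjoint)
  moreover have "A \<union> B = {(x, y). M x y \<and> n + a * b dvd a * x + b * y - k}"
    using M_out unfolding A_def B_def by (auto simp: not_less) (meson not_le)
  ultimately show ?thesis unfolding A_def B_def by simp
qed

text \<open>A block color collects the row boxes of color \<open>c + b * t\<close> and the column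
  boxes of color \<open>c + a * i\<close>. Row counts agree for \<open>c\<close> and
  \<open>c + a * i\<close>, column counts for \<open>c\<close> and \<open>c + b * t\<close>. Each of
  these three colors has \<open>r\<close> boxes in total, so the mixed sum is \<open>r\<close> as
  well.\<close>

lemma equidistributed_M:
  assumes "equidistributed a b n r L"
  shows "equidistributed a b (n + a * b) r M"
  unfolding equidistributed_def
proof
  fix k
  interpret T: stretching b a n c r Y X v "\<lambda>x y. L y x" "\<lambda>x y. M y x"
    by (rule stretching_transposed)
  have L_class: "int (card {(x, y). L x y \<and> n dvd a * x + b * y - w}) = r" for w
    using assms unfolding equidistributed_def by blast
  show "int (card {(x, y). M x y \<and> n + a * b dvd a * x + b * y - k}) = r"
  proof (cases rule: weight_cases[of k])
    case (shifted w)
    then show ?thesis using card_shifted_class[of w] L_class[of w] by simp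
  next
    case (block m i t)
    have "a * i < a * b" "b * t < a * b" using a_mult_less b_mult_less block by auto
    then have lt: "c + a * i < n" "c + b * t < n" using c_ab by linarith+
    have ai: "a * i \<in> nspan a b" and bt: "b * t \<in> nspan a b"
      using block by (auto intro: nspanI[of i 0] nspanI[of 0 t])
    have z: "0 \<in> nspan a b" "c + 0 < n" using c_ab ab_pos by (auto intro: nspanI[of 0 0])
    have "card {(x, y). M x y \<and> x < X \<and> n + a * b dvd a * x + b * y - k}
      = card {(x, y). M y x \<and> y < X \<and> n + a * b dvd a * y + b * x - k}"
      by (rule card_transpose[of "\<lambda>x y. M x y \<and> x < X \<and> n + a * b dvd a * x + b * y - k", symmetric])
    also have "\<dots> = card {(x, y). L y x \<and> y < X \<and> n dvd a * y + b * x - (c + a * i)}"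
      using T.card_row_block[OF block(3,4,1,2), of m] unfolding block(5) by (simp add: ac_simps)
    also have "\<dots> = card {(x, y). L x y \<and> x < X \<and> n dvd a * x + b * y - (c + a * i)}"
      by (rule card_transpose[of "\<lambda>x y. L x y \<and> x < X \<and> n dvd a * x + b * y - (c + a * i)"])
    finally have colb: "card {(x, y). M x y \<and> x < X \<and> n + a * b dvd a * x + b * y - k}
      = card {(x, y). L x y \<and> x < X \<and> n dvd a * x + b * y - (c + a * i)}" .
    have "card {(x, y). L x y \<and> x < X \<and> n dvd a * x + b * y - (c + b * t)}
      = card {(x, y). L y x \<and> y < X \<and> n dvd a * y + b * x - (c + b * t)}"
      by (rule card_transpose[of "\<lambda>x y. L x y \<and> x < X \<and> n dvd a * x + b * y - (c + b * t)", symmetric])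
    also have "\<dots> = card {(x, y). L y x \<and> y < X \<and> n dvd a * y + b * x - c}"
      using T.card_row_class[OF block(3,4)] by (simp add: ac_simps)
    also have "\<dots> = card {(x, y). L x y \<and> x < X \<and> n dvd a * x + b * y - c}"
      by (rule card_transpose[of "\<lambda>x y. L x y \<and> x < X \<and> n dvd a * x + b * y - c"])
    finally have colc: "card {(x, y). L x y \<and> x < X \<and> n dvd a * x + b * y - (c + b * t)}
      = card {(x, y). L x y \<and> x < X \<and> n dvd a * x + b * y - c}" .
    have rowb: "card {(x, y). M x y \<and> y < Y \<and> n + a * b dvd a * x + b * y - k}
      = card {(x, y). L x y \<and> y < Y \<and> n dvd a * x + b * y - (c + b * t)}"
      unfolding block(5) by (rule card_row_block[OF block(1-4)])
    have split: "card {(x, y). M x y \<and> n + a * b dvd a * x + b * y - k}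
      = card {(x, y). M x y \<and> y < Y \<and> n + a * b dvd a * x + b * y - k}
        + card {(x, y). M x y \<and> x < X \<and> n + a * b dvd a * x + b * y - k}"
      unfolding block(5) by (rule card_block_split[OF block(1-4)])
    show ?thesis
      using split rowb colb colc card_row_class[OF block(1,2)]
        card_class_split[OF ai lt(1)] card_class_split[OF bt lt(2)] card_class_split[OF z]
        L_class[of "c + a * i"] L_class[of "c + b * t"] L_class[of c]
      by simp
  qed
qed

lemma equidistributed_L:
  assumes "equidistributed a b (n + a * b) r M"
  shows "equidistributed a b n r L"
  unfolding equidistributed_def
proof
  fix k
  have "int (card {(x, y). M x y \<and> n + a * b dvd a * x + b * y - (k + a * b * v k)}) = r"
    using assms unfolding equidistributed_def by blast
  then show "int (card {(x, y). L x y \<and> n dvd a * x + b * y - k}) = r"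
    unfolding card_shifted_class .
qed

end

section \<open>Existence of contractions and stretchings\<close>

context levelled
begin

lemma shifted_x_nonneg:
  assumes "diagram M" "y < Y" "M (x + b * v (a * x + b * y)) y"
  shows "0 \<le> x"
proof (rule ccontr)
  assume x: "\<not> 0 \<le> x"
  then have "v (a * x + b * y) \<le> 0" using v_core[OF _ assms(2)] X_nonneg by simp
  then have "b * v (a * x + b * y) \<le> 0" using b_pos by (simp add: mult_nonneg_nonpos)
  then show False using diagram_pos[OF assms(1,3)] x by linarith
qed

text \<open>Straightness for the modulus \<open>n + a * b\<close>: the block starts at a cell of
  weight \<open>c + b * t + m * (n + a * b)\<close>, and \<open>b\<close> steps further is the image
  of \<open>(x, y)\<close>.\<close>

lemma straight_block:
  assumes M: "diagram M" "equidistributed a b (n + a * b) r M" "\<not> M X Y"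
    and y: "y < Y" and w: "a * x + b * y = c + m * n + b * t" and t: "0 \<le> t" "t < a"
    and i: "0 \<le> i" "i < b"
  shows "M (x + b * m + i) y = M (x + b * (m + 1)) y"
proof -
  interpret E: corner a b "n + a * b" c r X Y by (rule enlarged)
  have lt: "a * i < a * b" "b * t < a * b" using a_mult_less i b_mult_less t by auto
  have v: "v (a * x + b * y) = m + 1" unfolding w using v_block_b t by simp
  have x: "0 \<le> x + b * m" if "0 \<le> m"
    using v_row[OF y, of x] v that X_nonneg b_mult[OF that] by simp
  show ?thesis
  proof
    assume A: "M (x + b * m + i) y"
    have "a * (x + b * m + i) + b * y = (c + a * i + b * t) + m * (n + a * b)"
      using w by (simp add: algebra_simps)
    then have "0 \<le> (c + a * i + b * t) + m * (n + a * b)"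
      using diagram_pos[OF M(1) A] a_mult[of "x + b * m + i"] b_mult[of y] by linarith
    then have m: "0 \<le> m" by (rule E.mult_nonneg_if) (use lt c_ab in linarith)
    have A': "M (x + b * m) y"
      by (rule diagram_down[OF M(1) A]) (use x[OF m] i diagram_pos[OF M(1) A] in auto)
    have "a * (x + b * m) + b * y = c + b * t + m * (n + a * b)"
      using w by (simp add: algebra_simps)
    moreover have "c + a * b + b * t < n + a * b" using lt c_ab by linarith
    moreover have "b * t \<in> nspan a b" using t by (intro nspanI[of 0 t]) auto
    ultimately have "M (x + b * m + b) y" using E.straight(1)[OF M _ _ A' _ y] by blast
    then show "M (x + b * (m + 1)) y" by (simp add: algebra_simps)
  next
    assume A: "M (x + b * (m + 1)) y"
    have "a * (x + b * (m + 1)) + b * y = (c + a * b + b * t) + m * (n + a * b)"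
      using w by (simp add: algebra_simps)
    then have "0 \<le> (c + a * b + b * t) + m * (n + a * b)"
      using diagram_pos[OF M(1) A] a_mult[of "x + b * (m + 1)"] b_mult[of y] by linarith
    then have m: "0 \<le> m" by (rule E.mult_nonneg_if) (use lt c_ab in linarith)
    show "M (x + b * m + i) y"
      by (rule diagram_down[OF M(1) A])
        (use x[OF m] i diagram_pos[OF M(1) A] in \<open>auto simp: distrib_left\<close>)
  qed
qed

text \<open>Straightness with \<open>\<sigma> = a * b\<close>, which is admissible because the
  modulus has grown by \<open>a * b\<close>. It becomes \<open>row_straight\<close> for the
  contracted diagram.\<close>

lemma straight_above_block:
  assumes M: "diagram M" "equidistributed a b (n + a * b) r M" "\<not> M X Y"
    and y: "y < Y" and w: "a * x + b * y = c + m * n" and A: "M (x + b * (m + 1)) y"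
  shows "M (x + b + b * (m + 1)) y"
proof -
  interpret E: corner a b "n + a * b" c r X Y by (rule enlarged)
  have "a * (x + b * (m + 1)) + b * y = c + a * b + m * (n + a * b)"
    using w by (simp add: algebra_simps)
  moreover have "c + a * b + a * b < n + a * b" using c_ab by simp
  moreover have "a * b \<in> nspan a b" using b_pos by (intro nspanI[of b 0]) auto
  ultimately have "M (x + b * (m + 1) + b) y" using E.straight(1)[OF M _ _ A _ y] by blast
  then show ?thesis by (simp add: algebra_simps)
qed

text \<open>The blocks are deleted by reading \<open>M\<close> at shifted positions only. Levels
  grow with both coordinates, so down-closure is inherited, and finiteness follows from containment
  in \<open>M\<close>.\<close>

lemma contraction_exists:
  assumes M: "diagram M" "equidistributed a b (n + a * b) r M" "\<not> M X Y"
  obtains L where "stretching a b n c r X Y v L M"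
proof -
  interpret T: levelled b a n c r Y X v by (rule levelled_transposed)
  \<comment> \<open>On the core both ways of reading agree, because its cells have level 0.\<close>
  define L where "L = (\<lambda>x y. 0 \<le> x \<and> 0 \<le> y
    \<and> (if y < Y then M (x + b * v (a * x + b * y)) y
       else x < X \<and> M x (y + a * v (a * x + b * y))))"
  have MT: "diagram (\<lambda>x y. M y x)" "equidistributed b a (n + b * a) r (\<lambda>x y. M y x)" "\<not> M X Y"
    using diagram_transpose[OF M(1)] equidistributed_transpose[OF M(2)] M(3)
    by (simp_all add: mult.commute)
  have nn: "0 \<le> v (a * x + b * y)" if "0 \<le> x" "0 \<le> y" for x y
    by (rule v_nonneg) (use a_mult[OF that(1)] b_mult[OF that(2)] a_pos b_pos in linarith)
  have row: "M (x + b * v (a * x + b * y)) y = L x y" if "y < Y" for x y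
    using that shifted_x_nonneg[OF M(1) that, of x] diagram_pos[OF M(1)] unfolding L_def by auto
  have col: "M x (y + a * v (a * x + b * y)) = L x y" if x: "x < X" for x y
  proof (cases "y < Y \<and> 0 \<le> x \<and> 0 \<le> y")
    case True
    then have "v (a * x + b * y) = 0" using v_core[OF x, of y] nn[of x y] by simp
    then show ?thesis using True unfolding L_def by simp
  next
    case False
    have "0 \<le> y \<and> 0 \<le> x" if "M x (y + a * v (a * x + b * y))"
      using T.shifted_x_nonneg[OF MT(1) x, of y] that diagram_pos[OF M(1) that]
      by (simp add: add.commute)
    then show ?thesis using False x unfolding L_def by auto
  qed
  have LM: "M x y" if "L x y" for x y
  proof (cases "y < Y")
    case True
    have "M (x + b * v (a * x + b * y)) y" using row[OF True] that by simp
    then show ?thesis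
      by (rule diagram_down[OF M(1)]) (use that b_mult[OF nn] in \<open>auto simp: L_def\<close>)
  next
    case False
    then have "M x (y + a * v (a * x + b * y))" using that unfolding L_def by simp
    then show ?thesis
      by (rule diagram_down[OF M(1)]) (use that a_mult[OF nn] in \<open>auto simp: L_def\<close>)
  qed
  have L: "diagram L"
    unfolding diagram_def
  proof (intro conjI allI impI)
    show "finite {(x, y). L x y}"
      by (rule finite_subset[OF _ diagram_finite[OF M(1)]]) (use LM in auto)
  next
    fix x y x' y' assume A: "L x y \<and> 0 \<le> x' \<and> x' \<le> x \<and> 0 \<le> y' \<and> y' \<le> y"
    define k where "k = v (a * x + b * y)"
    define k' where "k' = v (a * x' + b * y')"
    have "a * (x - x') + b * (y - y') \<in> nspan a b" using A by (intro nspanI[of "x - x'" "y - y'"]) auto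
    from v_mono[OF this, of "a * x' + b * y'"] have kk: "k' \<le> k"
      unfolding k_def k'_def by (simp add: algebra_simps)
    then have le: "b * k' \<le> b * k" "a * k' \<le> a * k" using a_pos b_pos by auto
    have k'0: "0 \<le> a * k'" "0 \<le> b * k'" using nn[of x' y'] A a_mult b_mult unfolding k'_def by auto
    show "L x' y'"
    proof (cases "y < Y")
      case True
      then have "M (x + b * k) y" using row[OF True, of x] A unfolding k_def by simp
      then have "M (x' + b * k') y'"
        by (rule diagram_down[OF M(1)]) (use A le k'0 in auto)
      then show ?thesis using row[of y' x'] True A unfolding k'_def by simp
    next
      case False
      then have x: "x < X" using A unfolding L_def by simp
      then have "M x (y + a * k)" using col[OF x, of y] A unfolding k_def by simp
      then have "M x' (y' + a * k')"
        by (rule diagram_down[OF M(1)]) (use A le k'0 in auto)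
      then show ?thesis using col[of x' y'] x A unfolding k'_def by simp
    qed
  qed (auto simp: L_def)
  have "stretching a b n c r X Y v L M"
  proof (rule stretching.intro[OF levelled_axioms], rule stretching_axioms.intro)
    show "\<not> L X Y" unfolding L_def by simp
    show "M (x + b * m + i) y = L x y"
      if "y < Y" "a * x + b * y = c + m * n + b * t" "0 \<le> t" "t < a" "0 \<le> i" "i < b" for x y m t i
      using straight_block[OF M that] row[OF that(1), of x] v_block_b[of t m] that by simp
    show "M x (y + a * m + t) = L x y"
      if "x < X" "a * x + b * y = c + m * n + a * i" "0 \<le> i" "i < b" "0 \<le> t" "t < a" for x y m i t
      using T.straight_block[OF MT that(1) _ that(3-6), of y m] col[OF that(1), of y]
        v_block_a[of i m] that by (simp add: add.commute)
    show "L (x + b) y" if "y < Y" "a * x + b * y = c + m * n" "L x y" for x y m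
    proof -
      have "M (x + b * (m + 1)) y" using row[OF that(1), of x] that v_block_b[of 0 m] a_pos by simp
      from straight_above_block[OF M that(1,2) this] have "M (x + b + b * (m + 1)) y" .
      moreover have "a * (x + b) + b * y = c + m * n + a * b" using that(2) by (simp add: algebra_simps)
      then have "v (a * (x + b) + b * y) = m + 1" using v_block_a[of b m] b_pos by simp
      ultimately show ?thesis using row[OF that(1), of "x + b"] by simp
    qed
    show "L x (y + a)" if "x < X" "a * x + b * y = c + m * n" "L x y" for x y m
    proof -
      have "M x (y + a * (m + 1))" using col[OF that(1), of y] that v_block_b[of 0 m] a_pos by simp
      then have "M x (y + a + a * (m + 1))"
        using T.straight_above_block[OF MT that(1), of y m] that(2) by (simp add: add.commute)
      moreover have "a * x + b * (y + a) = c + m * n + b * a" using that(2) by (simp add: algebra_simps)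
      then have "v (a * x + b * (y + a)) = m + 1" using v_block_b[of a m] a_pos by simp
      ultimately show ?thesis using col[OF that(1), of "y + a"] by simp
    qed
  qed (fact L M row col)+
  then show ?thesis using that by blast
qed

end

text \<open>Each row is filled up to the farthest image of one of its boxes, so that the blocks need
  no separate description.\<close>

definition row_stretch ::
  "int \<Rightarrow> int \<Rightarrow> int \<Rightarrow> (int \<Rightarrow> int) \<Rightarrow> (int \<Rightarrow> int \<Rightarrow> bool) \<Rightarrow> int \<Rightarrow> int \<Rightarrow> bool" where
  "row_stretch a b Y v L x y \<longleftrightarrow>
     y < Y \<and> 0 \<le> x \<and> (\<exists>u. L u y \<and> x \<le> u + b * v (a * u + b * y))"

context levelled
begin

lemma row_stretchI:
  "y < Y \<Longrightarrow> 0 \<le> x \<Longrightarrow> L u y \<Longrightarrow> x \<le> u + b * v (a * u + b * y) \<Longrightarrow> row_stretch a b Y v L x y"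
  unfolding row_stretch_def by blast

lemma row_stretchE:
  assumes "row_stretch a b Y v L x y"
  obtains u where "y < Y" "0 \<le> x" "L u y" "x \<le> u + b * v (a * u + b * y)"
  using assms unfolding row_stretch_def by blast

lemma v_row_mono: "x \<le> x' \<Longrightarrow> v (a * x + b * y) \<le> v (a * x' + b * y)"
  using v_mono[of "a * (x' - x)" "a * x + b * y"] nspanI[of "x' - x" 0 "a * (x' - x)" a b]
  by (simp add: algebra_simps)

lemma v_cell: "0 \<le> x \<Longrightarrow> 0 \<le> y \<Longrightarrow> 0 \<le> v (a * x + b * y)"
  using a_mult[of x] b_mult[of y] a_pos b_pos by (intro v_nonneg) linarith

text \<open>One row lower the level of a box may drop by one, making its image too short. Then its
  weight is \<open>c + m * n + a * i\<close>, and straightness supplies a box of the row whose image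
  in the lower row reaches far enough.\<close>

lemma row_stretch_down_step:
  assumes L: "diagram L"
    and st: "\<And>x y m. \<lbrakk>y < Y; a * x + b * y = c + m * n; L x y\<rbrakk> \<Longrightarrow> L (x + b) y"
    and R: "row_stretch a b Y v L x y" and y: "1 \<le> y"
  shows "row_stretch a b Y v L x (y - 1)"
proof -
  obtain u where u: "y < Y" "0 \<le> x" "L u y" "x \<le> u + b * v (a * u + b * y)"
    using R by (rule row_stretchE)
  have pos: "0 \<le> u" "0 \<le> y" using diagram_pos[OF L u(3)] by auto
  have down: "L u' (y - 1)" if "L u' y" for u'
    by (rule diagram_down[OF L that]) (use y diagram_pos[OF L that] in auto)
  define w where "w = a * u + b * y"
  define m where "m = v (w - b)"
  have wb: "a * u + b * (y - 1) = w - b" unfolding w_def by (simp add: algebra_simps)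
  have "v w = m \<or> v w = m + 1" using v_le(2)[of w] v_ge(2)[of w] unfolding m_def by linarith
  then show ?thesis
  proof
    assume "v w = m"
    then have "x \<le> u + b * v (a * u + b * (y - 1))" using u(4) unfolding wb m_def w_def by simp
    then show ?thesis using u down[OF u(3)] by (intro row_stretchI[of _ _ _ u]) auto
  next
    assume vm: "v w = m + 1"
    have m0: "0 \<le> m" using v_cell[of u "y - 1"] pos y wb unfolding m_def by simp
    have "m < v w" using vm by simp
    then have "w - c - m * n \<in> nspan a b" unfolding v_iff .
    then obtain i t where it: "0 \<le> i" "0 \<le> t" "w - c - m * n = a * i + b * t" by (rule nspanE)
    have "\<not> m < v (w - b)" unfolding m_def by simp
    then have no: "a * i + b * t - b \<notin> nspan a b" unfolding v_iff using it by (simp add: algebra_simps)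
    have t0: "t = 0"
    proof (rule ccontr)
      assume "t \<noteq> 0"
      then show False using no it by (auto intro!: nspanI[of i "t - 1"] simp: algebra_simps)
    qed
    have q: "a * (u - i) + b * y = c + m * n" using it t0 w_def by (simp add: algebra_simps)
    have "v (a * (u - i) + b * y) = m + 1" using v_block_a[of 0 m] b_pos q by simp
    then have ui: "0 \<le> u - i" using v_row[OF u(1), of "u - i"] m0 X_nonneg by simp
    have "L (u - i) y" by (rule diagram_down[OF L u(3)]) (use it ui pos in auto)
    from st[OF u(1) q this] have s: "L (u - i + b) y" .
    \<comment> \<open>The cell \<open>(u - i + b, y - 1)\<close> has weight
      \<open>c + m * n + b * (a - 1)\<close> and thus level \<open>m + 1\<close> again. Taking the
      maximum avoids comparing \<open>i\<close> with \<open>b\<close>.\<close>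
    define u2 where "u2 = max u (u - i + b)"
    have "L u2 y" unfolding u2_def using u(3) s by (simp add: max_def)
    then have L2: "L u2 (y - 1)" by (rule down)
    have "a * (u - i + b) + b * (y - 1) = c + m * n + b * (a - 1)"
      using q by (simp add: algebra_simps)
    then have "v (a * (u - i + b) + b * (y - 1)) = m + 1" using v_block_b[of "a - 1" m] a_pos by simp
    then have "m + 1 \<le> v (a * u2 + b * (y - 1))"
      using v_row_mono[of "u - i + b" u2 "y - 1"] unfolding u2_def by simp
    then have "b * (m + 1) \<le> b * v (a * u2 + b * (y - 1))" using b_pos by simp
    then have "x \<le> u2 + b * v (a * u2 + b * (y - 1))"
      using u(4) vm unfolding u2_def w_def[symmetric] by simp
    then show ?thesis using u L2 by (intro row_stretchI[of _ _ _ u2]) auto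
  qed
qed

lemma row_stretch_down:
  assumes L: "diagram L"
    and st: "\<And>x y m. \<lbrakk>y < Y; a * x + b * y = c + m * n; L x y\<rbrakk> \<Longrightarrow> L (x + b) y"
    and R: "row_stretch a b Y v L x y" and le: "0 \<le> x'" "x' \<le> x" "0 \<le> y'" "y' \<le> y"
  shows "row_stretch a b Y v L x' y'"
proof -
  have "row_stretch a b Y v L x y'" using le(4,3)
  proof (induction y' rule: int_le_induct)
    case base
    show ?case by (rule R)
  next
    case (step z)
    show ?case by (rule row_stretch_down_step[OF L st]) (use step in auto)
  qed
  then show ?thesis using le unfolding row_stretch_def by force
qed

lemma row_stretch_pos: "diagram L \<Longrightarrow> row_stretch a b Y v L x y \<Longrightarrow> 0 \<le> x \<and> 0 \<le> y"
  using diagram_pos unfolding row_stretch_def by blast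

lemma row_stretch_finite:
  assumes "diagram L"
  shows "finite {(x, y). row_stretch a b Y v L x y}"
proof (rule finite_subset)
  show "{(x, y). row_stretch a b Y v L x y}
    \<subseteq> (\<Union>(u, y) \<in> {(x, y). L x y}. {0..u + b * v (a * u + b * y)} \<times> {y})"
    unfolding row_stretch_def by auto
qed (use diagram_finite[OF assms] in auto)

text \<open>The shift is strictly increasing, so the image of a cell is reached only from boxes at
  or beyond it.\<close>

lemma row_stretch_shift:
  assumes L: "diagram L" and y: "y < Y"
  shows "row_stretch a b Y v L (x + b * v (a * x + b * y)) y = L x y"
proof
  assume A: "L x y"
  then have "0 \<le> v (a * x + b * y)" using diagram_pos[OF L] v_cell by blast
  then have "0 \<le> x + b * v (a * x + b * y)" using diagram_pos[OF L A] b_mult by simp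
  then show "row_stretch a b Y v L (x + b * v (a * x + b * y)) y"
    using row_stretchI[where L = L and u = x] y A by simp
next
  assume "row_stretch a b Y v L (x + b * v (a * x + b * y)) y"
  then obtain u where u: "0 \<le> x + b * v (a * x + b * y)" "L u y"
    "x + b * v (a * x + b * y) \<le> u + b * v (a * u + b * y)" by (rule row_stretchE)
  have "x \<le> u"
  proof (rule ccontr)
    assume "\<not> x \<le> u"
    moreover from this have "b * v (a * u + b * y) \<le> b * v (a * x + b * y)"
      using v_row_mono b_pos by simp
    ultimately show False using u(3) by linarith
  qed
  moreover have "0 \<le> x"
  proof (rule ccontr)
    assume x: "\<not> 0 \<le> x"
    then have "v (a * x + b * y) \<le> 0" using v_core[OF _ y] X_nonneg by simp
    then have "b * v (a * x + b * y) \<le> 0" using b_pos by (simp add: mult_nonneg_nonpos)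
    then show False using u(1) x by linarith
  qed
  ultimately show "L x y" using diagram_down[OF L u(2)] diagram_pos[OF L u(2)] by blast
qed

lemma row_stretch_block:
  assumes L: "diagram L" and y: "y < Y" and w: "a * x + b * y = c + m * n + b * t"
    and t: "0 \<le> t" "t < a" and i: "0 \<le> i" "i < b"
  shows "row_stretch a b Y v L (x + b * m + i) y = L x y"
proof
  have v: "v (a * x + b * y) = m + 1" unfolding w using v_block_b t by simp
  have c0: "c + b * t < n" using b_mult_less[OF t(2)] c_ab by linarith
  {
    assume A: "L x y"
    have pos: "0 \<le> x" "0 \<le> y" using diagram_pos[OF L A] by auto
    have "0 \<le> c + b * t + m * n" using w a_mult[OF pos(1)] b_mult[OF pos(2)] by linarith
    then have "0 \<le> m" using c0 by (rule mult_nonneg_if)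
    then have "0 \<le> x + b * m + i" using pos b_mult i by simp
    moreover have "x + b * m + i \<le> x + b * v (a * x + b * y)"
      unfolding v using i by (simp add: distrib_left)
    ultimately show "row_stretch a b Y v L (x + b * m + i) y"
      using row_stretchI[where L = L and u = x] y A by simp
  }
  assume "row_stretch a b Y v L (x + b * m + i) y"
  then obtain u where u: "0 \<le> x + b * m + i" "L u y"
    "x + b * m + i \<le> u + b * v (a * u + b * y)" by (rule row_stretchE)
  have pos: "0 \<le> u" "0 \<le> y" using diagram_pos[OF L u(2)] by auto
  \<comment> \<open>A box left of \<open>x\<close> has level at most \<open>m\<close> by
    \<open>v_block_b_pred\<close>, so its image stops short of the block.\<close>
  have "x \<le> u"
  proof (rule ccontr)
    assume "\<not> x \<le> u"
    then have "v (a * u + b * y) \<le> v (a * (x - 1) + b * y)" by (intro v_row_mono) simp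
    also have "a * (x - 1) + b * y = c + m * n + b * t - a" using w by (simp add: algebra_simps)
    also have "v \<dots> \<le> m" using v_block_b_pred t by simp
    finally have "b * v (a * u + b * y) \<le> b * m" using b_pos by simp
    then show False using u(3) i \<open>\<not> x \<le> u\<close> by linarith
  qed
  moreover have "0 \<le> x"
  proof (cases "0 \<le> m")
    case True
    then show ?thesis using v_row[OF y, of x] v X_nonneg by simp
  next
    case False
    have "b * m \<le> b * (- 1)" using False b_pos by (intro mult_left_mono) auto
    then show ?thesis using u(1) i by linarith
  qed
  ultimately show "L x y" using diagram_down[OF L u(2)] pos by blast
qed

text \<open>Below height \<open>Y\<close> a column runs through the core and is not lengthened. So
  uniting stretched rows and columns adds nothing to the rows below \<open>Y\<close>.\<close>

lemma col_stretch_low: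
  assumes "diagram L" "row_stretch b a X v (\<lambda>x y. L y x) y x" "y < Y"
  shows "row_stretch a b Y v L x y"
proof -
  obtain z where z: "x < X" "0 \<le> y" "L x z" "y \<le> z + a * v (b * z + a * x)"
    using assms(2) unfolding row_stretch_def by blast
  have pos: "0 \<le> x" "0 \<le> z" using diagram_pos[OF assms(1) z(3)] by auto
  have "y \<le> z"
  proof (rule ccontr)
    assume "\<not> y \<le> z"
    then have "v (a * x + b * z) \<le> 0" using v_core[OF z(1)] assms(3) by simp
    then have "a * v (b * z + a * x) \<le> 0" using a_pos by (simp add: mult_nonneg_nonpos add.commute)
    then show False using z(4) \<open>\<not> y \<le> z\<close> by linarith
  qed
  then have "L x y" using diagram_down[OF assms(1) z(3)] pos z(2) by simp
  then show ?thesis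
    using assms(3) pos b_mult[OF v_cell[OF pos(1) z(2)]] by (intro row_stretchI[of _ _ _ x]) auto
qed

text \<open>The union of the stretched rows and the stretched columns is down-closed, as each of
  them is, and by \<open>col_stretch_low\<close> and its transpose it restricts to one of them on
  each side.\<close>

lemma stretch_exists:
  assumes L: "diagram L" "equidistributed a b n r L" "\<not> L X Y"
  obtains M where "stretching a b n c r X Y v L M"
proof -
  interpret T: levelled b a n c r Y X v by (rule levelled_transposed)
  have LT: "diagram (\<lambda>x y. L y x)" by (rule diagram_transpose[OF L(1)])
  have s0: "0 \<in> nspan a b" "c + a * b + 0 < n" using c_ab by (auto intro: nspanI[of 0 0])
  have strow: "L (x + b) y" if "y < Y" "a * x + b * y = c + m * n" "L x y" for x y m
    using straight(1)[OF L s0 that(3), of m] that by simp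
  have stcol: "L x (y + a)" if "x < X" "a * x + b * y = c + m * n" "L x y" for x y m
    using straight(2)[OF L s0 that(3), of m] that by simp
  have stT: "L y (x + a)" if "y < X" "b * x + a * y = c + m * n" "L y x" for x y m
    using stcol[OF that(1) _ that(3), of m] that(2) by (simp add: add.commute)
  define R where "R = row_stretch a b Y v L"
  define C where "C = (\<lambda>x y. row_stretch b a X v (\<lambda>x y. L y x) y x)"
  define M where "M = (\<lambda>x y. R x y \<or> C x y)"
  have MR: "M x y = R x y" if "y < Y" for x y
    using col_stretch_low[OF L(1) _ that] unfolding M_def C_def R_def by blast
  have MC: "M x y = C x y" if "x < X" for x y
    using T.col_stretch_low[OF LT _ that] unfolding M_def C_def R_def by blast
  have M: "diagram M"
    unfolding diagram_def
  proof (intro conjI allI impI)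
    fix x y assume "M x y"
    then show "0 \<le> x" "0 \<le> y"
      using row_stretch_pos[OF L(1)] T.row_stretch_pos[OF LT]
      unfolding M_def R_def C_def by blast+
  next
    fix x y x' y' assume A: "M x y \<and> 0 \<le> x' \<and> x' \<le> x \<and> 0 \<le> y' \<and> y' \<le> y"
    have "R x y \<Longrightarrow> R x' y'" unfolding R_def
      by (rule row_stretch_down[OF L(1) strow]) (use A in auto)
    moreover have "C x y \<Longrightarrow> C x' y'" unfolding C_def
      by (rule T.row_stretch_down[OF LT stT]) (use A in auto)
    ultimately show "M x' y'" using A unfolding M_def by blast
  next
    have "{(x, y). M x y} = {(x, y). R x y} \<union> {(x, y). C x y}" unfolding M_def by blast
    moreover have "finite {(x, y). R x y}" unfolding R_def by (rule row_stretch_finite[OF L(1)])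
    moreover have "finite {(x, y). C x y}"
      unfolding C_def by (rule finite_transpose[OF T.row_stretch_finite[OF LT]])
    ultimately show "finite {(x, y). M x y}" by simp
  qed
  have "stretching a b n c r X Y v L M"
  proof (rule stretching.intro[OF levelled_axioms], rule stretching_axioms.intro)
    show "\<not> M X Y" unfolding M_def R_def C_def row_stretch_def by simp
    show "M (x + b * v (a * x + b * y)) y = L x y" if "y < Y" for x y
      using row_stretch_shift[OF L(1) that] MR[OF that] unfolding R_def by simp
    show "M x (y + a * v (a * x + b * y)) = L x y" if "x < X" for x y
      using T.row_stretch_shift[OF LT that, of y] MC[OF that] unfolding C_def
      by (simp add: add.commute)
    show "M (x + b * m + i) y = L x y"
      if "y < Y" "a * x + b * y = c + m * n + b * t" "0 \<le> t" "t < a" "0 \<le> i" "i < b" for x y m t i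
      using row_stretch_block[OF L(1) that] MR[OF that(1)] unfolding R_def by simp
    show "M x (y + a * m + t) = L x y"
      if "x < X" "a * x + b * y = c + m * n + a * i" "0 \<le> i" "i < b" "0 \<le> t" "t < a" for x y m i t
      using T.row_stretch_block[OF LT that(1) _ that(3-6), of y m] that(2) MC[OF that(1)]
      unfolding C_def by (simp add: add.commute)
  qed (fact L M strow stcol)+
  then show ?thesis using that by blast
qed

end

section \<open>Choice of the corner and assembly of the bijection\<close>

definition first_gap :: "int \<Rightarrow> int \<Rightarrow> int \<Rightarrow> (int \<Rightarrow> int \<Rightarrow> bool) \<Rightarrow> int \<Rightarrow> bool" where
  "first_gap a b r L s \<longleftrightarrow> 0 \<le> s \<and> s \<le> r \<and> \<not> L ((r - s) * b) (s * a)
     \<and> (\<forall>s'. 0 \<le> s' \<and> s' < s \<longrightarrow> L ((r - s') * b) (s' * a))"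

text \<open>Taking the least \<open>s\<close> makes the corner canonical, so that the constructions
  for different corners fit together to one bijection.\<close>

lemma first_gap_unique: "first_gap a b r L s \<Longrightarrow> first_gap a b r L s' \<Longrightarrow> s = s'"
  unfolding first_gap_def by (metis linorder_neqE)

text \<open>Pigeonhole: the \<open>r + 1\<close> candidate cells all have weight
  \<open>r * a * b\<close>, while their color has only \<open>r\<close> boxes.\<close>

lemma first_gap_exists:
  assumes L: "diagram L" "equidistributed a b n r L" and "0 < a" "0 < r"
  obtains s where "first_gap a b r L s"
proof -
  define g where "g = (\<lambda>s. ((r - s) * b, s * a))"
  define P where "P = {(x, y). L x y \<and> n dvd a * x + b * y - r * a * b}"
  have "\<exists>s. 0 \<le> s \<and> s \<le> r \<and> \<not> L ((r - s) * b) (s * a)"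
  proof (rule ccontr)
    assume "\<not> ?thesis"
    then have all: "L ((r - s) * b) (s * a)" if "0 \<le> s" "s \<le> r" for s using that by blast
    have "g ` {0..r} \<subseteq> P"
    proof
      fix p assume "p \<in> g ` {0..r}"
      then obtain s where s: "0 \<le> s" "s \<le> r" "p = g s" by auto
      have "a * ((r - s) * b) + b * (s * a) - r * a * b = 0" by (simp add: algebra_simps)
      then have "n dvd a * ((r - s) * b) + b * (s * a) - r * a * b" by simp
      then show "p \<in> P" using all[OF s(1,2)] s(3) unfolding P_def g_def by simp
    qed
    moreover have "finite P"
      unfolding P_def by (auto intro!: finite_subset[OF _ diagram_finite[OF L(1)]])
    moreover have "inj_on g {0..r}" using \<open>0 < a\<close> unfolding g_def by (auto simp: inj_on_def)
    ultimately have "card {0..r} \<le> card P" by (metis card_image card_mono)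
    moreover have "int (card P) = r" using L(2) unfolding equidistributed_def P_def by blast
    ultimately show False using \<open>0 < r\<close> by simp
  qed
  then obtain s0 where s0: "0 \<le> s0" "s0 \<le> r" "\<not> L ((r - s0) * b) (s0 * a)" by blast
  define Q where "Q = (\<lambda>k. \<not> L ((r - int k) * b) (int k * a))"
  have Q0: "Q (nat s0)" using s0 unfolding Q_def by simp
  define k where "k = (LEAST k. Q k)"
  have "Q k" unfolding k_def by (rule LeastI[of Q, OF Q0])
  moreover have "k \<le> nat s0" unfolding k_def by (rule Least_le[of Q, OF Q0])
  moreover have "L ((r - s') * b) (s' * a)" if "0 \<le> s'" "s' < int k" for s'
  proof -
    have "\<not> Q (nat s')" using not_less_Least[of "nat s'" Q] that unfolding k_def[symmetric] by simp
    then show ?thesis using that unfolding Q_def by simp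
  qed
  ultimately have "first_gap a b r L (int k)"
    using s0 unfolding first_gap_def Q_def by simp
  then show ?thesis using that by blast
qed

text \<open>The earlier candidates lie in rows below \<open>s * a\<close> and have weight
  \<open>c + a * b\<close>, where \<open>rim_agree\<close> applies.\<close>

lemma first_gap_stretching:
  assumes "stretching a b n c r ((r - s) * b) (s * a) v L M"
  shows "first_gap a b r L s \<longleftrightarrow> first_gap a b r M s"
proof -
  interpret stretching a b n c r "(r - s) * b" "s * a" v L M by (rule assms)
  have "M ((r - s') * b) (s' * a) = L ((r - s') * b) (s' * a)" if "s' < s" for s'
  proof (rule rim_agree)
    show "s' * a < s * a" using that a_pos by simp
    show "a * ((r - s') * b) + b * (s' * a) = c + a * b" unfolding c_eq by (simp add: algebra_simps)
  qed
  then show ?thesis using L_corner M_corner unfolding first_gap_def by auto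
qed

lemma bij_betw_from_relation:
  assumes "\<And>x. x \<in> A \<Longrightarrow> \<exists>y \<in> B. R x y" "\<And>y. y \<in> B \<Longrightarrow> \<exists>x \<in> A. R x y"
    and "\<And>x y y'. R x y \<Longrightarrow> R x y' \<Longrightarrow> y = y'" "\<And>x x' y. R x y \<Longrightarrow> R x' y \<Longrightarrow> x = x'"
  shows "\<exists>f. bij_betw f A B \<and> (\<forall>x \<in> A. R x (f x))"
proof -
  obtain f where f: "\<And>x. x \<in> A \<Longrightarrow> f x \<in> B \<and> R x (f x)" using assms(1) by metis
  have "inj_on f A" by (rule inj_onI) (metis f assms(4))
  moreover have "f ` A = B"
  proof (intro equalityI subsetI)
    fix y assume "y \<in> B"
    then obtain x where "x \<in> A" "R x y" using assms(2) by blast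
    then show "y \<in> f ` A" using f assms(3) by (metis imageI)
  qed (use f in auto)
  ultimately show ?thesis using f unfolding bij_betw_def by blast
qed

lemma diagram_bijection:
  fixes a b n r :: int
  assumes ab: "0 < a" "0 < b" "coprime a b" and r: "0 < r" and n: "r * a * b < n"
  shows "\<exists>f. bij_betw f {L. diagram L \<and> equidistributed a b n r L}
      {L. diagram L \<and> equidistributed a b (n + a * b) r L}
    \<and> (\<forall>L \<in> {L. diagram L \<and> equidistributed a b n r L}.
      card (dpairs a b (n + a * b) (f L)) = card (dpairs a b n L)
      \<and> card (upairs b (n + a * b) (f L)) = card (upairs b n L))"
proof -
  define c where "c = (r - 1) * a * b"
  have corner: "corner a b n c r ((r - s) * b) (s * a)" if "0 \<le> s" "s \<le> r" for s
    by standard (use assms that in \<open>auto simp: c_def\<close>)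
  \<comment> \<open>The level function does not depend on \<open>s\<close>, so the corner with
    \<open>s = 0\<close> provides one \<open>v\<close> for all corners.\<close>
  interpret C: corner a b n c r "r * b" 0 using corner[of 0] r by simp
  obtain v where v: "\<And>k w. k < v w \<longleftrightarrow> w - c - k * n \<in> nspan a b" using C.level_exists by blast
  have levelled: "levelled a b n c r ((r - s) * b) (s * a) v" if "0 \<le> s" "s \<le> r" for s
    using corner[OF that] v by (simp add: levelled_def levelled_axioms_def)
  define R where "R = (\<lambda>L M. \<exists>s. first_gap a b r L s \<and> first_gap a b r M s
    \<and> stretching a b n c r ((r - s) * b) (s * a) v L M)"
  have "\<exists>f. bij_betw f {L. diagram L \<and> equidistributed a b n r L}
      {L. diagram L \<and> equidistributed a b (n + a * b) r L}
    \<and> (\<forall>L \<in> {L. diagram L \<and> equidistributed a b n r L}. R L (f L))"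
  proof (rule bij_betw_from_relation)
    fix L assume "L \<in> {L. diagram L \<and> equidistributed a b n r L}"
    then have L: "diagram L" "equidistributed a b n r L" by auto
    obtain s where s: "first_gap a b r L s" using first_gap_exists[OF L ab(1) r] .
    interpret V: levelled a b n c r "(r - s) * b" "s * a" v
      using levelled s unfolding first_gap_def by blast
    have "\<not> L ((r - s) * b) (s * a)" using s unfolding first_gap_def by blast
    then obtain M where M: "stretching a b n c r ((r - s) * b) (s * a) v L M"
      using V.stretch_exists[OF L] by blast
    interpret S: stretching a b n c r "(r - s) * b" "s * a" v L M by (rule M)
    show "\<exists>M \<in> {L. diagram L \<and> equidistributed a b (n + a * b) r L}. R L M"
      using S.M S.equidistributed_M[OF L(2)] M s first_gap_stretching[OF M] unfolding R_def by blast
  next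
    fix M assume "M \<in> {L. diagram L \<and> equidistributed a b (n + a * b) r L}"
    then have M: "diagram M" "equidistributed a b (n + a * b) r M" by auto
    obtain s where s: "first_gap a b r M s" using first_gap_exists[OF M ab(1) r] .
    interpret V: levelled a b n c r "(r - s) * b" "s * a" v
      using levelled s unfolding first_gap_def by blast
    have "\<not> M ((r - s) * b) (s * a)" using s unfolding first_gap_def by blast
    then obtain L where L: "stretching a b n c r ((r - s) * b) (s * a) v L M"
      using V.contraction_exists[OF M] by blast
    interpret S: stretching a b n c r "(r - s) * b" "s * a" v L M by (rule L)
    show "\<exists>L \<in> {L. diagram L \<and> equidistributed a b n r L}. R L M"
      using S.L S.equidistributed_L[OF M(2)] L s first_gap_stretching[OF L] unfolding R_def by blast
  next
    fix L M M' assume "R L M" "R L M'"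
    then obtain s where "stretching a b n c r ((r - s) * b) (s * a) v L M"
      "stretching a b n c r ((r - s) * b) (s * a) v L M'"
      unfolding R_def using first_gap_unique by blast
    then show "M = M'" by (metis stretching.M_determined)
  next
    fix L L' M assume "R L M" "R L' M"
    then obtain s where "stretching a b n c r ((r - s) * b) (s * a) v L M"
      "stretching a b n c r ((r - s) * b) (s * a) v L' M"
      unfolding R_def using first_gap_unique by blast
    then show "L = L'" by (metis stretching.L_determined)
  qed
  moreover have "card (dpairs a b (n + a * b) M) = card (dpairs a b n L)
      \<and> card (upairs b (n + a * b) M) = card (upairs b n L)" if "R L M" for L M
    using that stretching.card_dpairs stretching.card_upairs unfolding R_def by blast
  ultimately show ?thesis by blast
qed

section \<open>Sets of boxes\<close>

definition cells :: "(nat \<times> nat) set \<Rightarrow> int \<Rightarrow> int \<Rightarrow> bool" where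
  "cells Y x y \<longleftrightarrow> 0 \<le> x \<and> 0 \<le> y \<and> (nat x, nat y) \<in> Y"

lemma cells_int [simp]: "cells Y (int i) (int j) \<longleftrightarrow> (i, j) \<in> Y"
  unfolding cells_def by simp

lemma cellsE:
  assumes "cells Y x y"
  obtains i j where "x = int i" "y = int j" "(i, j) \<in> Y"
  using assms unfolding cells_def by (metis int_nat_eq)

lemma cells_image: "{(x, y). cells Y x y \<and> P x y} = map_prod int int ` {(i, j). (i, j) \<in> Y \<and> P (int i) (int j)}"
  by (auto elim!: cellsE)

lemma inj_map_int: "inj_on (map_prod int int) A"
  by (auto simp: inj_on_def)

lemma diagram_cells:
  assumes "young Y"
  shows "diagram (cells Y)"
  unfolding diagram_def
proof (intro conjI allI impI)
  show "finite {(x, y). cells Y x y}"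
    using cells_image[of Y "\<lambda>_ _. True"] assms unfolding young_def by simp
next
  fix x y x' y' assume A: "cells Y x y \<and> 0 \<le> x' \<and> x' \<le> x \<and> 0 \<le> y' \<and> y' \<le> y"
  then have "(nat x, nat y) \<in> Y" "nat x' \<le> nat x" "nat y' \<le> nat y" unfolding cells_def by auto
  then have "(nat x', nat y') \<in> Y" using assms unfolding young_def by blast
  then show "cells Y x' y'" using A unfolding cells_def by simp
qed (auto simp: cells_def)

lemma young_of_diagram:
  assumes "diagram L"
  shows "young {(i, j). L (int i) (int j)}" and "cells {(i, j). L (int i) (int j)} = L"
proof -
  show eq: "cells {(i, j). L (int i) (int j)} = L"
    using diagram_pos[OF assms] unfolding cells_def by (intro ext) auto
  have "map_prod int int ` {(i, j). L (int i) (int j)} \<subseteq> {(x, y). L x y}" by auto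
  then have "finite (map_prod int int ` {(i, j). L (int i) (int j)})"
    using finite_subset diagram_finite[OF assms] by blast
  then have "finite {(i, j). L (int i) (int j)}" by (rule finite_imageD[OF _ inj_map_int])
  moreover have "L (int i') (int j')" if "L (int i) (int j)" "i' \<le> i" "j' \<le> j" for i j i' j'
    by (rule diagram_down[OF assms that(1)]) (use that in auto)
  ultimately show "young {(i, j). L (int i) (int j)}" unfolding young_def by auto
qed

lemma balanced_iff_equidistributed:
  assumes "0 < n"
  shows "balanced r a b n Y \<longleftrightarrow> equidistributed a b n (int r) (cells Y)"
proof -
  have eq: "card {p \<in> Y. color a b n p = k mod n}
    = card {(x, y). cells Y x y \<and> n dvd a * x + b * y - k}" for k
  proof -
    have "{(i, j). (i, j) \<in> Y \<and> n dvd a * int i + b * int j - k} = {p \<in> Y. color a b n p = k mod n}"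
      unfolding color_def by (auto simp: mod_eq_dvd_iff)
    then show ?thesis unfolding cells_image by (simp add: card_image[OF inj_map_int])
  qed
  have "balanced r a b n Y \<longleftrightarrow> (\<forall>k. card {p \<in> Y. color a b n p = k mod n} = r)"
  proof
    assume "\<forall>k. card {p \<in> Y. color a b n p = k mod n} = r"
    then have "card {p \<in> Y. color a b n p = k} = r" if "k \<in> {0..<n}" for k
      using that by (metis atLeastLessThan_iff mod_pos_pos_trivial)
    then show "balanced r a b n Y" unfolding balanced_def by blast
  qed (use assms in \<open>auto simp: balanced_def\<close>)
  then show ?thesis unfolding equidistributed_def eq by simp
qed

lemma balanced_card:
  assumes "finite Y" "balanced r a b n Y" "0 < n"
  shows "int (card Y) = int r * n"
proof -
  have "Y = (\<Union>k \<in> {0..<n}. {p \<in> Y. color a b n p = k})"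
    using assms(3) unfolding color_def by auto
  then have "card Y = card (\<Union>k \<in> {0..<n}. {p \<in> Y. color a b n p = k})" by simp
  also have "\<dots> = (\<Sum>k \<in> {0..<n}. card {p \<in> Y. color a b n p = k})"
    by (rule card_UN_disjoint) (use assms(1) in auto)
  also have "\<dots> = (\<Sum>k \<in> {0..<n}. r)"
    by (rule sum.cong) (use assms(2) in \<open>auto simp: balanced_def\<close>)
  also have "\<dots> = r * nat n" by simp
  finally show ?thesis using assms(3) by simp
qed

lemma Bset_eq:
  assumes "0 < n"
  shows "Bset r a b n = {Y. young Y \<and> equidistributed a b n (int r) (cells Y)}"
  using balanced_card[OF _ _ assms] balanced_iff_equidistributed[OF assms]
  unfolding Bset_def young_def by blast

lemma bij_betw_cells:
  assumes "0 < n"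
  shows "bij_betw cells (Bset r a b n) {L. diagram L \<and> equidistributed a b n (int r) L}"
proof (rule bij_betw_imageI)
  show "inj_on cells (Bset r a b n)"
  proof (rule inj_onI)
    fix Y Z assume "cells Y = cells Z"
    then have "p \<in> Y \<longleftrightarrow> p \<in> Z" for p using cells_int by (metis surj_pair)
    then show "Y = Z" by blast
  qed
  show "cells ` Bset r a b n = {L. diagram L \<and> equidistributed a b n (int r) L}"
    unfolding Bset_eq[OF assms]
  proof (intro equalityI subsetI)
    fix L assume L: "L \<in> {L. diagram L \<and> equidistributed a b n (int r) L}"
    then show "L \<in> cells ` {Y. young Y \<and> equidistributed a b n (int r) (cells Y)}"
      using young_of_diagram[of L] by (intro rev_image_eqI[of "{(i, j). L (int i) (int j)}"]) auto
  qed (use diagram_cells in auto)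
qed

section \<open>Row and column lengths, and the Betti statistic\<close>

lemma initial_segment_card:
  fixes A :: "nat set"
  assumes "finite A" "\<And>i i'. i \<in> A \<Longrightarrow> i' \<le> i \<Longrightarrow> i' \<in> A"
  shows "i \<in> A \<longleftrightarrow> i < card A"
proof -
  have "A = {..<card A}"
  proof (rule card_subset_eq[OF _ _ , symmetric])
    show "{..<card A} \<subseteq> A"
    proof (rule ccontr)
      assume "\<not> {..<card A} \<subseteq> A"
      then obtain k where k: "k < card A" "k \<notin> A" by auto
      then have "A \<subseteq> {..<k}" using assms(2) by (metis lessThan_iff not_le subsetI)
      then have "card A \<le> k" by (metis card_lessThan card_mono finite_lessThan)
      then show False using k by simp
    qed
  qed (use assms in auto)
  then show ?thesis by (metis lessThan_iff)
qed

lemma young_lcnt: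
  assumes "young Y"
  shows "(i, j) \<in> Y \<longleftrightarrow> i < lcnt Y j"
proof -
  have "{i. (i, j) \<in> Y} \<subseteq> fst ` Y" by force
  then have "finite {i. (i, j) \<in> Y}" using assms finite_subset unfolding young_def by blast
  from initial_segment_card[OF this, of i] show ?thesis
    using assms unfolding young_def lcnt_def by blast
qed

lemma young_ccnt:
  assumes "young Y"
  shows "(i, j) \<in> Y \<longleftrightarrow> j < ccnt Y i"
proof -
  have "{j. (i, j) \<in> Y} \<subseteq> snd ` Y" by force
  then have "finite {j. (i, j) \<in> Y}" using assms finite_subset unfolding young_def by blast
  from initial_segment_card[OF this, of j] show ?thesis
    using assms unfolding young_def ccnt_def by blast
qed

lemma cells_outer:
  assumes Y: "young Y" and p: "\<not> cells Y x y" "cells Y (x - 1) y"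
  shows "x = int (lcnt Y (nat y))"
proof -
  obtain i j where ij: "x - 1 = int i" "y = int j" "(i, j) \<in> Y" using p(2) by (rule cellsE)
  have "x = int (Suc i)" using ij(1) by simp
  then have "(Suc i, j) \<notin> Y" using p(1) ij(2) by (metis cells_int)
  then show ?thesis using ij young_lcnt[OF Y] by (simp add: less_Suc_eq)
qed

lemma cells_top:
  assumes Y: "young Y" and p: "cells Y x y" "\<not> cells Y x (y + 1)"
  shows "y = int (ccnt Y (nat x)) - 1"
proof -
  obtain i j where ij: "x = int i" "y = int j" "(i, j) \<in> Y" using p(1) by (rule cellsE)
  have "y + 1 = int (Suc j)" using ij(2) by simp
  then have "(i, Suc j) \<notin> Y" using p(2) ij(1) by (metis cells_int)
  then show ?thesis using ij young_ccnt[OF Y] by (simp add: less_Suc_eq)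
qed

text \<open>A box \<open>(i, j)\<close> selects the end of row \<open>j\<close> and the top of
  column \<open>i\<close>; conversely, \<open>y \<le> y'\<close> guarantees that the crossing of
  such a row and column is a box.\<close>

lemma card_d_inv:
  assumes Y: "young Y"
  shows "card {(i, j) \<in> Y. d_inv a b n Y i j} = card (dpairs a b n (cells Y))"
proof -
  define g where "g = (\<lambda>(i, j). ((int (lcnt Y j), int j), (int i, int (ccnt Y i) - 1)))"
  define P where "P = {(i, j) \<in> Y. d_inv a b n Y i j}"
  have dvd: "d_inv a b n Y i j \<longleftrightarrow>
      n dvd (a * int (lcnt Y j) + b * int j) - (a * int i + b * (int (ccnt Y i) - 1))" for i j
    unfolding d_inv_def invariant_arrow_def by (simp add: mod_eq_0_iff_dvd algebra_simps)
  have "inj_on g P" unfolding g_def by (auto simp: inj_on_def)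
  moreover have "g ` P = dpairs a b n (cells Y)"
  proof (intro equalityI subsetI)
    fix q assume "q \<in> g ` P"
    then obtain i j where ij: "(i, j) \<in> Y" "d_inv a b n Y i j" "q = g (i, j)"
      unfolding P_def by auto
    have l: "i < lcnt Y j" and c: "j < ccnt Y i" using ij young_lcnt[OF Y] young_ccnt[OF Y] by auto
    have "int (lcnt Y j) - 1 = int (lcnt Y j - 1)" "(lcnt Y j - 1, j) \<in> Y"
      using l young_lcnt[OF Y] by auto
    then have "cells Y (int (lcnt Y j) - 1) (int j)" by (metis cells_int)
    moreover have "\<not> cells Y (int (lcnt Y j)) (int j)" using young_lcnt[OF Y] by simp
    moreover have "int (ccnt Y i) - 1 = int (ccnt Y i - 1)" "(i, ccnt Y i - 1) \<in> Y"
      using c young_ccnt[OF Y] by auto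
    then have "cells Y (int i) (int (ccnt Y i) - 1)" by (metis cells_int)
    moreover have "\<not> cells Y (int i) (int (ccnt Y i) - 1 + 1)" using young_ccnt[OF Y] by simp
    moreover have "int j \<le> int (ccnt Y i) - 1" using c by simp
    moreover note ij(2)[unfolded dvd]
    ultimately show "q \<in> dpairs a b n (cells Y)"
      unfolding ij(3) dpairs_def g_def prod.case mem_Collect_eq by blast
  next
    fix q assume q: "q \<in> dpairs a b n (cells Y)"
    obtain x y x' y' where q': "q = ((x, y), (x', y'))" by (metis surj_pair)
    have p: "\<not> cells Y x y" "cells Y (x - 1) y" "cells Y x' y'" "\<not> cells Y x' (y' + 1)" "y \<le> y'"
      "n dvd (a * x + b * y) - (a * x' + b * y')"
      using q unfolding q' dpairs_def by auto
    obtain j where j: "y = int j" using p(2) by (rule cellsE)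
    obtain i where i: "x' = int i" using p(3) by (rule cellsE)
    have x: "x = int (lcnt Y j)" using cells_outer[OF Y p(1,2)] j by simp
    have y': "y' = int (ccnt Y i) - 1" using cells_top[OF Y p(3,4)] i by simp
    have "(i, j) \<in> Y" using young_ccnt[OF Y] p(5) y' j by simp
    then have "(i, j) \<in> P" unfolding P_def using dvd p(6) x y' i j by simp
    moreover have "q = g (i, j)" unfolding g_def q' using x y' i j by simp
    ultimately show "q \<in> g ` P" by blast
  qed
  ultimately have "card (dpairs a b n (cells Y)) = card P" using card_image[of g P] by simp
  then show ?thesis unfolding P_def by simp
qed

text \<open>For \<open>i = l(j) - 1\<close> the arrow is vertical, so \<open>a\<close> cancels from
  the invariance condition.\<close>

lemma card_u_inv:
  assumes Y: "young Y"
  shows "card {(i, j) \<in> Y. u_inv a b n Y i j \<and> int i = int (lcnt Y j) - 1}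
    = card (upairs b n (cells Y))"
proof -
  define g where "g = (\<lambda>(i, j). (int i, int j, int (ccnt Y i)))"
  define P where "P = {(i, j) \<in> Y. u_inv a b n Y i j \<and> int i = int (lcnt Y j) - 1}"
  have dvd: "u_inv a b n Y i j \<longleftrightarrow> n dvd b * (int (ccnt Y i) - int j)"
    if "int i = int (lcnt Y j) - 1" for i j
    unfolding u_inv_def invariant_arrow_def by (simp add: that mod_eq_0_iff_dvd)
  have "inj_on g P" unfolding g_def by (auto simp: inj_on_def)
  moreover have "g ` P = upairs b n (cells Y)"
  proof (intro equalityI subsetI)
    fix q assume "q \<in> g ` P"
    then obtain i j where ij: "(i, j) \<in> Y" "u_inv a b n Y i j" "int i = int (lcnt Y j) - 1"
      "q = g (i, j)"
      unfolding P_def by auto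
    have c: "j < ccnt Y i" using ij young_ccnt[OF Y] by auto
    have "(Suc i, j) \<notin> Y" using young_lcnt[OF Y] ij(3) by simp
    moreover have "int i + 1 = int (Suc i)" by simp
    ultimately have "\<not> cells Y (int i + 1) (int j)" using cells_int by metis
    moreover have "int (ccnt Y i) - 1 = int (ccnt Y i - 1)" "(i, ccnt Y i - 1) \<in> Y"
      using c young_ccnt[OF Y] by auto
    then have "cells Y (int i) (int (ccnt Y i) - 1)" by (metis cells_int)
    moreover have "\<not> cells Y (int i) (int (ccnt Y i))" using young_ccnt[OF Y] by simp
    moreover have "cells Y (int i) (int j)" using ij(1) by simp
    moreover note ij(2)[unfolded dvd[OF ij(3)]]
    ultimately show "q \<in> upairs b n (cells Y)"
      unfolding ij(4) upairs_def g_def prod.case mem_Collect_eq by blast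
  next
    fix q assume q: "q \<in> upairs b n (cells Y)"
    obtain x y y' where q': "q = (x, y, y')" by (metis surj_pair)
    have p: "cells Y x y" "\<not> cells Y (x + 1) y" "\<not> cells Y x y'" "cells Y x (y' - 1)"
      "n dvd b * (y' - y)"
      using q unfolding q' upairs_def by auto
    obtain i j where ij: "x = int i" "y = int j" "(i, j) \<in> Y" using p(1) by (rule cellsE)
    have y': "y' = int (ccnt Y i)"
      using cells_top[OF Y p(4)] p(3) ij by simp
    have l: "int i = int (lcnt Y j) - 1"
      using cells_outer[OF Y p(2)] p(1) ij by simp
    have "(i, j) \<in> P" unfolding P_def using dvd[OF l] p(5) y' ij l by simp
    moreover have "q = g (i, j)" unfolding g_def q' using y' ij by simp
    ultimately show "q \<in> g ` P" by blast
  qed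
  ultimately have "card (upairs b n (cells Y)) = card P" using card_image[of g P] by simp
  then show ?thesis unfolding P_def by simp
qed

lemma betti_eq:
  "young Y \<Longrightarrow> betti a b n Y = card (dpairs a b n (cells Y)) + card (upairs b n (cells Y))"
  unfolding betti_def by (simp only: card_d_inv card_u_inv)

section \<open>Positive parameters, and reduction to them by a change of sign\<close>

lemma theorem1p2_pos:
  fixes r :: nat and a b n :: int
  assumes "r > 0" and ab: "0 < a" "0 < b" "coprime a b" and n: "n > int r * a * b"
  shows "\<exists>f. bij_betw f (Bset r a b n) (Bset r a b (n + a * b)) \<and>
             (\<forall>Y \<in> Bset r a b n. betti a b (n + a * b) (f Y) = betti a b n Y)"
proof -
  have "0 \<le> int r * a * b" "0 < a * b" using ab by simp_all
  then have n0: "0 < n" "0 < n + a * b" using n by linarith+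
  obtain f where f: "bij_betw f {L. diagram L \<and> equidistributed a b n (int r) L}
      {L. diagram L \<and> equidistributed a b (n + a * b) (int r) L}"
    "\<And>L. diagram L \<Longrightarrow> equidistributed a b n (int r) L \<Longrightarrow>
      card (dpairs a b (n + a * b) (f L)) = card (dpairs a b n L)
      \<and> card (upairs b (n + a * b) (f L)) = card (upairs b n L)"
    using diagram_bijection[OF ab, of "int r" n] assms by auto
  define h where "h = inv_into (Bset r a b (n + a * b)) cells"
  note bij1 = bij_betw_cells[OF n0(1), of r a b] and bij2 = bij_betw_cells[OF n0(2), of r a b]
  have bij: "bij_betw (h \<circ> (f \<circ> cells)) (Bset r a b n) (Bset r a b (n + a * b))"
    unfolding h_def by (intro bij_betw_trans[OF bij_betw_trans[OF bij1 f(1)]] bij_betw_inv_into bij2)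
  moreover have "betti a b (n + a * b) ((h \<circ> (f \<circ> cells)) Y) = betti a b n Y"
    if Y: "Y \<in> Bset r a b n" for Y
  proof -
    define Z where "Z = (h \<circ> (f \<circ> cells)) Y"
    have "Z \<in> Bset r a b (n + a * b)" using bij Y unfolding Z_def by (metis bij_betwE)
    then have Z: "young Z" unfolding Bset_def by simp
    have L: "young Y" "diagram (cells Y)" "equidistributed a b n (int r) (cells Y)"
      using Y diagram_cells unfolding Bset_eq[OF n0(1)] by auto
    have "f (cells Y) \<in> {L. diagram L \<and> equidistributed a b (n + a * b) (int r) L}"
      using bij_betwE[OF f(1)] L by blast
    then have "cells Z = f (cells Y)"
      unfolding Z_def h_def comp_def by (rule bij_betw_inv_into_right[OF bij2])
    then show ?thesis
      using f(2)[OF L(2,3)] unfolding Z_def[symmetric] betti_eq[OF Z] betti_eq[OF L(1)] by simp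
  qed
  ultimately show ?thesis by blast
qed

text \<open>Negating both parameters exchanges the color classes of \<open>m\<close> and
  \<open>- m\<close>, which only permutes classes of equal size.\<close>

lemma Bset_uminus:
  assumes "0 < n"
  shows "Bset r (- a) (- b) n = Bset r a b n"
proof -
  have "equidistributed (- a) (- b) n k L" if "equidistributed a b n k L" for a b k L
    unfolding equidistributed_def
  proof
    fix m
    have "n dvd - a * x + - b * y - m \<longleftrightarrow> n dvd a * x + b * y - (- m)" for x y
    proof -
      have "- a * x + - b * y - m = - (a * x + b * y - (- m))" by simp
      then show ?thesis by (metis dvd_minus_iff)
    qed
    moreover have "int (card {(x, y). L x y \<and> n dvd a * x + b * y - (- m)}) = k"
      using that unfolding equidistributed_def by blast
    ultimately show "int (card {(x, y). L x y \<and> n dvd - a * x + - b * y - m}) = k" by presburger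
  qed
  from this[of a b] this[of "- a" "- b"] show ?thesis unfolding Bset_eq[OF assms] by auto
qed

lemma betti_uminus: "betti (- a) (- b) n Y = betti a b n Y"
proof -
  have "invariant_arrow (- a) (- b) n p q = invariant_arrow a b n p q" for p q
    unfolding invariant_arrow_def mod_eq_0_iff_dvd
    using dvd_minus_iff[of n "a * (fst p - fst q) + b * (snd p - snd q)"]
    by (simp add: algebra_simps)
  then show ?thesis unfolding betti_def d_inv_def u_inv_def by simp
qed

theorem theorem1p2:
  fixes r :: nat and a b n :: int
  assumes "r > 0" and "gcd a b = 1" and "a * b > 0" and "n > int r * a * b"
  shows "\<exists>f. bij_betw f (Bset r a b n) (Bset r a b (n + a * b)) \<and>
             (\<forall>Y \<in> Bset r a b n. betti a b (n + a * b) (f Y) = betti a b n Y)"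
proof (cases "0 < a")
  case True
  then have "0 < b" using assms(3) by (simp add: zero_less_mult_iff)
  then show ?thesis using theorem1p2_pos[OF assms(1) True] assms(2,4) coprime_iff_gcd_eq_1 by blast
next
  case False
  \<comment> \<open>Both signs change together, so \<open>a * b\<close> and hence both moduli stay
    the same.\<close>
  then have ab: "0 < - a" "0 < - b" using assms(3) by (auto simp: zero_less_mult_iff)
  have "0 \<le> int r * (a * b)" using assms(3) by simp
  then have n0: "0 < n" "0 < n + a * b" using assms(3,4) unfolding mult.assoc by linarith+
  have "coprime (- a) (- b)" using assms(2) by (simp add: coprime_iff_gcd_eq_1[symmetric])
  from theorem1p2_pos[OF assms(1) ab this, of n] assms(4) show ?thesis
    by (simp add: Bset_uminus[OF n0(1)] Bset_uminus[OF n0(2)] betti_uminus)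
qed

end
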